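(* Let $T:E\to X$ be a bounded linear operator from a Banach lattice $E$ into a Banach space $X$. Then $T$ is a $DW$-DP operator if and only if $T$ is both a weak Dunford-Pettis operator and an order Dunford-Pettis operator.
   Context: All Banach spaces and Banach lattices are real; $X'$ is the topological dual of $X$. For a subset $A$ of a Banach lattice $E$, $Sol(A)=\{y\in E: |y|\le |x| \text{ for some } x\in A\}$. A sequence $(x_n)$ in $E$ is disjoint if $|x_n|\wedge|x_m|=0$ for $n\ne m$. A bounded subset $A$ of $E$ is disjointly weakly compact if every disjoint sequence in $Sol(A)$ converges weakly to zero. A bounded subset $A$ of a Banach space $X$ is a Dunford-Pettis set if $\sup_{x\in A}|f_n(x)|\to 0$ for every weakly null sequence $(f_n)$ in $X'$. A bounded linear operator $T:E\to X$ is: $DW$-DP if $T(A)$ is a Dunford-Pettis set for each disjointly weakly compact subset $A$ of $E$; weak Dunford-Pettis if $f_n(Tx_n)\to 0$ whenever $x_n\to 0$ weakly in $E$ and $f_n\to 0$ weakly in $X'$; order Dunford-Pettis if $T$ maps order bounded subsets of $E$ to Dunford-Pettis subsets of $X$. *)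

theory Defs
  imports "HOL-Analysis.Analysis" "HOL-Library.Lattice_Algebras"
begin

text \<open>The modulus is the lattice modulus: \<open>lattice_ab_group_add_abs\<close> provides
  \<open>\<bar>x\<bar> = sup x (- x)\<close>.\<close>

class banach_lattice = banach + ordered_real_vector + lattice_ab_group_add_abs +
  assumes norm_mono_abs: "\<bar>x\<bar> \<le> \<bar>y\<bar> \<Longrightarrow> norm x \<le> norm y"

text \<open>The topological dual of \<open>'a\<close> is the Banach space \<open>'a \<Rightarrow>\<^sub>L real\<close> with the operator norm, so
  for a sequence in the dual the functionals \<open>\<phi>\<close> below range over the bidual (this is weak, not
  weak-star, convergence).\<close>

definition weakly_null :: "(nat \<Rightarrow> 'a::real_normed_vector) \<Rightarrow> bool" where
  "weakly_null x \<longleftrightarrow> (\<forall>\<phi> :: 'a \<Rightarrow>\<^sub>L real. (\<lambda>n. \<phi> (x n)) \<longlonglongrightarrow> 0)"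

definition Sol :: "'a::banach_lattice set \<Rightarrow> 'a set" where
  "Sol A = {y. \<exists>x\<in>A. \<bar>y\<bar> \<le> \<bar>x\<bar>}"

definition disjoint_seq :: "(nat \<Rightarrow> 'a::banach_lattice) \<Rightarrow> bool" where
  "disjoint_seq x \<longleftrightarrow> (\<forall>n m. n \<noteq> m \<longrightarrow> inf \<bar>x n\<bar> \<bar>x m\<bar> = 0)"

definition disjointly_weakly_compact :: "'a::banach_lattice set \<Rightarrow> bool" where
  "disjointly_weakly_compact A \<longleftrightarrow>
     bounded A \<and> (\<forall>x. range x \<subseteq> Sol A \<and> disjoint_seq x \<longrightarrow> weakly_null x)"

text \<open>The supremum is taken in \<open>[0, \<infinity>]\<close>, so that it is \<open>0\<close> for empty \<open>A\<close>; on \<open>real\<close>, \<open>Sup {}\<close> is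
  an unspecified value.\<close>

definition Dunford_Pettis_set :: "'a::banach set \<Rightarrow> bool" where
  "Dunford_Pettis_set A \<longleftrightarrow>
     bounded A \<and>
     (\<forall>f :: nat \<Rightarrow> ('a \<Rightarrow>\<^sub>L real). weakly_null f \<longrightarrow>
        (\<lambda>n. SUP x\<in>A. ennreal \<bar>blinfun_apply (f n) x\<bar>) \<longlonglongrightarrow> 0)"

definition order_bounded :: "'a::banach_lattice set \<Rightarrow> bool" where
  "order_bounded A \<longleftrightarrow> (\<exists>a b. A \<subseteq> {a..b})"

definition DW_DP :: "('a::banach_lattice \<Rightarrow>\<^sub>L 'b::banach) \<Rightarrow> bool" where
  "DW_DP T \<longleftrightarrow> (\<forall>A. disjointly_weakly_compact A \<longrightarrow> Dunford_Pettis_set (T ` A))"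

definition weak_Dunford_Pettis :: "('a::banach_lattice \<Rightarrow>\<^sub>L 'b::banach) \<Rightarrow> bool" where
  "weak_Dunford_Pettis T \<longleftrightarrow>
     (\<forall>(x :: nat \<Rightarrow> 'a) (f :: nat \<Rightarrow> ('b \<Rightarrow>\<^sub>L real)).
        weakly_null x \<and> weakly_null f \<longrightarrow> (\<lambda>n. blinfun_apply (f n) (T (x n))) \<longlonglongrightarrow> 0)"

definition order_Dunford_Pettis :: "('a::banach_lattice \<Rightarrow>\<^sub>L 'b::banach) \<Rightarrow> bool" where
  "order_Dunford_Pettis T \<longleftrightarrow> (\<forall>A. order_bounded A \<longrightarrow> Dunford_Pettis_set (T ` A))"

end

theory Submission imports Defs begin

text \<open>
  If \<open>T\<close> is DW-DP, it suffices that order intervals and ranges of weakly null sequences are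
  disjointly weakly compact. For a disjoint sequence \<open>y\<close> with \<open>\<bar>y\<^sub>k\<bar> \<le> \<bar>u\<bar>\<close> and a functional \<open>f\<close>,
  \<open>\<Sum>\<bar>f y\<^sub>k\<bar> \<le> \<parallel>f\<parallel> \<parallel>u\<parallel>\<close>. If instead \<open>\<bar>y\<^sub>k\<bar> \<le> \<bar>x\<^sub>k\<bar>\<close> with \<open>x\<close> weakly null, Hahn-Banach gives
  functionals \<open>g\<^sub>k\<close>, carried by the bands of the \<open>y\<^sub>k\<close>, with \<open>\<Sum>\<bar>g\<^sub>k z\<bar> \<le> \<parallel>f\<parallel> \<parallel>z\<parallel>\<close> and
  \<open>\<bar>f y\<^sub>k\<bar> \<le> g\<^sub>k x\<^sub>k\<close>. So \<open>z \<mapsto> (g\<^sub>k z)\<^sub>k\<close> maps into \<open>l\<^sup>1\<close>, where weakly null sequences are norm null.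

  Conversely let \<open>f\<close> be weakly null and \<open>A\<close> disjointly weakly compact. As \<open>T\<close> is weak Dunford-Pettis,
  \<open>f\<^sub>n \<circ> T\<close> tends to zero uniformly in \<open>n\<close> along disjoint sequences of \<open>Sol A\<close>. Hence it is uniformly
  small on the elements \<open>(\<bar>x\<bar> - u)\<^sup>+\<close>, \<open>x \<in> Sol A\<close>, for a suitable \<open>u \<ge> 0\<close>. The remaining parts lie in
  \<open>{0..u}\<close>, where the order Dunford-Pettis property applies.
\<close>

subsection \<open>Hahn-Banach and uniform boundedness\<close>

definition sublinear :: "('a::real_vector \<Rightarrow> real) \<Rightarrow> bool" where
  "sublinear p \<longleftrightarrow> (\<forall>x y. p (x + y) \<le> p x + p y) \<and> (\<forall>c x. 0 \<le> c \<longrightarrow> p (c *\<^sub>R x) = c * p x)"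

lemma sublinear_add: "sublinear p \<Longrightarrow> p (x + y) \<le> p x + p y"
  by (simp add: sublinear_def)

lemma sublinear_scaleR: "sublinear p \<Longrightarrow> 0 \<le> c \<Longrightarrow> p (c *\<^sub>R x) = c * p x"
  by (simp add: sublinear_def)

lemma sublinear_0: "sublinear p \<Longrightarrow> p 0 = 0"
  using sublinear_scaleR[of p 0 0] by simp

lemma sublinear_minus: "sublinear p \<Longrightarrow> - p (- x) \<le> p x"
  using sublinear_add[of p x "- x"] by (simp add: sublinear_0)

text \<open>For \<open>q\<close> and \<open>r\<close> in the chain, the smaller one \<open>s\<close>
  gives \<open>s (x + y) \<le> s x + s y \<le> q x + r y\<close>, and the infima over
  \<open>q\<close> and \<open>r\<close> can then be taken separately. This supplies the lower bounds
  for Zorn's lemma.\<close>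

lemma sublinear_Inf_chain:
  fixes C :: "('a::real_vector \<Rightarrow> real) set"
  assumes sub: "\<And>q. q \<in> C \<Longrightarrow> sublinear q" and ne: "C \<noteq> {}"
    and chain: "\<And>q r. q \<in> C \<Longrightarrow> r \<in> C \<Longrightarrow> q \<le> r \<or> r \<le> q"
    and bdd: "\<And>x. bdd_below ((\<lambda>q. q x) ` C)"
  shows "sublinear (\<lambda>x. INF q\<in>C. q x)"
  unfolding sublinear_def
proof (intro conjI allI impI)
  fix x y
  have low: "(INF q\<in>C. q (x + y)) \<le> q x + r y" if qr: "q \<in> C" "r \<in> C" for q r
  proof -
    obtain s where s: "s \<in> C" "s \<le> q" "s \<le> r"
      using chain[OF qr] qr by blast
    have "(INF q\<in>C. q (x + y)) \<le> s (x + y)"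
      by (rule cINF_lower[OF bdd s(1)])
    also have "\<dots> \<le> s x + s y" by (rule sublinear_add[OF sub[OF s(1)]])
    also have "\<dots> \<le> q x + r y" using s by (auto simp: le_fun_def intro!: add_mono)
    finally show ?thesis .
  qed
  have "(INF q\<in>C. q (x + y)) - r y \<le> (INF q\<in>C. q x)" if "r \<in> C" for r
    by (rule cINF_greatest[OF ne]) (use low[OF _ that] in \<open>simp add: algebra_simps\<close>)
  then have "(INF q\<in>C. q (x + y)) - (INF q\<in>C. q x) \<le> (INF q\<in>C. q y)"
    by (intro cINF_greatest[OF ne]) (simp add: algebra_simps)
  then show "(INF q\<in>C. q (x + y)) \<le> (INF q\<in>C. q x) + (INF q\<in>C. q y)" by simp
next
  fix c :: real and x :: 'a assume c: "0 \<le> c"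
  show "(INF q\<in>C. q (c *\<^sub>R x)) = c * (INF q\<in>C. q x)"
  proof (cases "c = 0")
    case True
    have "(\<lambda>q. q 0) ` C = {0}" using sub ne by (auto simp: sublinear_0 image_iff)
    then show ?thesis using True by simp
  next
    case False
    with c have c: "c > 0" by simp
    show ?thesis
    proof (rule antisym)
      have "(INF q\<in>C. q (c *\<^sub>R x)) / c \<le> (INF q\<in>C. q x)"
      proof (rule cINF_greatest[OF ne])
        fix q assume q: "q \<in> C"
        show "(INF q\<in>C. q (c *\<^sub>R x)) / c \<le> q x"
          using cINF_lower[OF bdd q, of "c *\<^sub>R x"] sublinear_scaleR[OF sub[OF q], of c x] c
          by (simp add: field_simps)
      qed
      then show "(INF q\<in>C. q (c *\<^sub>R x)) \<le> c * (INF q\<in>C. q x)"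
        using c by (simp add: field_simps)
      show "c * (INF q\<in>C. q x) \<le> (INF q\<in>C. q (c *\<^sub>R x))"
      proof (rule cINF_greatest[OF ne])
        fix q assume q: "q \<in> C"
        show "c * (INF q\<in>C. q x) \<le> q (c *\<^sub>R x)"
          using cINF_lower[OF bdd q, of x] sublinear_scaleR[OF sub[OF q], of c x] c by simp
      qed
    qed
  qed
qed

text \<open>Since \<open>shifted p y\<close> is sublinear and lies below \<open>p\<close>, a minimal sublinear \<open>p\<close> equals
  \<open>shifted p y\<close>, whence \<open>p x \<le> p (x + y) - p y\<close>: it is additive.\<close>

definition shifted :: "('a::real_vector \<Rightarrow> real) \<Rightarrow> 'a \<Rightarrow> 'a \<Rightarrow> real" where
  "shifted p y x = (INF t\<in>{0..}. p (x + t *\<^sub>R y) - t * p y)"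

lemma shifted_bdd_below:
  assumes p: "sublinear p"
  shows "bdd_below ((\<lambda>t. p (x + t *\<^sub>R y) - t * p y) ` {0..})"
proof (rule bdd_belowI2)
  fix t :: real assume "t \<in> {0..}"
  then show "- p (- x) \<le> p (x + t *\<^sub>R y) - t * p y"
    using sublinear_add[OF p, of "x + t *\<^sub>R y" "- x"] sublinear_scaleR[OF p, of t y] by simp
qed

lemma shifted_le:
  assumes "sublinear p" "0 \<le> t"
  shows "shifted p y x \<le> p (x + t *\<^sub>R y) - t * p y"
  unfolding shifted_def using assms by (intro cINF_lower[OF shifted_bdd_below]) auto

lemma shifted_le_self: "sublinear p \<Longrightarrow> shifted p y x \<le> p x"
  using shifted_le[of p 0 y x] by simp

text \<open>Parameters \<open>s\<close> for \<open>a\<close> and \<open>t\<close> for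
  \<open>b\<close> combine to the parameter \<open>s + t\<close> for \<open>a + b\<close>, which
  gives subadditivity. Homogeneity comes from rescaling the half-line by \<open>c\<close>.\<close>

lemma sublinear_shifted:
  assumes p: "sublinear p"
  shows "sublinear (shifted p y)"
  unfolding sublinear_def
proof (intro conjI allI impI)
  have ne: "{0::real..} \<noteq> {}" by auto
  fix a b
  have low: "shifted p y (a + b) \<le> (p (a + s *\<^sub>R y) - s * p y) + (p (b + t *\<^sub>R y) - t * p y)"
    if "0 \<le> s" "0 \<le> t" for s t
    using shifted_le[OF p, of "s + t" y "a + b"] that
      sublinear_add[OF p, of "a + s *\<^sub>R y" "b + t *\<^sub>R y"]
    by (simp add: algebra_simps)
  have "shifted p y (a + b) - (p (b + t *\<^sub>R y) - t * p y) \<le> shifted p y a" if "0 \<le> t" for t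
    unfolding shifted_def[of p y a]
    using low[OF _ that] by (intro cINF_greatest[OF ne]) (simp add: algebra_simps)
  then have "shifted p y (a + b) - shifted p y a \<le> shifted p y b"
    unfolding shifted_def[of p y b] by (intro cINF_greatest[OF ne]) (simp add: algebra_simps)
  then show "shifted p y (a + b) \<le> shifted p y a + shifted p y b" by simp
next
  have ne: "{0::real..} \<noteq> {}" by auto
  fix c :: real and x assume c0: "0 \<le> c"
  show "shifted p y (c *\<^sub>R x) = c * shifted p y x"
  proof (cases "c = 0")
    case True
    have "(\<lambda>t. p (0 + t *\<^sub>R y) - t * p y) ` {0..} = {0}"
      using sublinear_scaleR[OF p, of _ y] by (auto simp: image_iff)
    then show ?thesis using True by (simp add: shifted_def)
  next
    case False
    with c0 have c: "c > 0" by simp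
    show ?thesis
    proof (rule antisym)
      have "shifted p y (c *\<^sub>R x) / c \<le> shifted p y x"
        unfolding shifted_def[of p y x]
      proof (rule cINF_greatest[OF ne])
        fix t :: real assume t: "t \<in> {0..}"
        show "shifted p y (c *\<^sub>R x) / c \<le> p (x + t *\<^sub>R y) - t * p y"
          using shifted_le[OF p, of "c * t" y "c *\<^sub>R x"]
            sublinear_scaleR[OF p, of c "x + t *\<^sub>R y"] c t
          by (simp add: field_simps scaleR_add_right)
      qed
      then show "shifted p y (c *\<^sub>R x) \<le> c * shifted p y x"
        using c by (simp add: field_simps)
      show "c * shifted p y x \<le> shifted p y (c *\<^sub>R x)"
        unfolding shifted_def[of p y "c *\<^sub>R x"]
      proof (rule cINF_greatest[OF ne])
        fix t :: real assume t: "t \<in> {0..}"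
        have "c * shifted p y x \<le> c * (p (x + (t / c) *\<^sub>R y) - (t / c) * p y)"
          using shifted_le[OF p, of "t / c" y x] c t by simp
        also have "\<dots> = p (c *\<^sub>R x + t *\<^sub>R y) - t * p y"
          using sublinear_scaleR[OF p, of c "x + (t / c) *\<^sub>R y"] c
          by (simp add: algebra_simps)
        finally show "c * shifted p y x \<le> p (c *\<^sub>R x + t *\<^sub>R y) - t * p y" .
      qed
    qed
  qed
qed

text \<open>Zorn's lemma, for the reversed order, yields a minimal sublinear \<open>m\<close> below
  \<open>p\<close>. Minimality forces \<open>shifted m y = m\<close> for every \<open>y\<close>, so
  \<open>m\<close> is additive, hence odd, hence homogeneous for negative scalars too.\<close>

lemma ex_linear_le_sublinear:
  fixes p :: "'a::real_vector \<Rightarrow> real"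
  assumes p: "sublinear p"
  shows "\<exists>g. linear g \<and> g \<le> p"
proof -
  define A where "A = {q. sublinear q \<and> q \<le> p}"
  have "\<exists>m\<in>A. \<forall>a\<in>A. m \<ge> a \<longrightarrow> a = m"
  proof (rule predicate_Zorn)
    show "partial_order_on A (relation_of (\<ge>) A)"
      by (rule partial_order_on_relation_ofI) auto
    fix C assume C: "C \<in> Chains (relation_of (\<ge>) A)"
    show "\<exists>u\<in>A. \<forall>a\<in>C. a \<ge> u"
    proof (cases "C = {}")
      case True
      then show ?thesis using p by (auto simp: A_def)
    next
      case False
      have CA: "C \<subseteq> A" by (rule Chains_relation_of[OF C])
      have chain: "q \<le> r \<or> r \<le> q" if "q \<in> C" "r \<in> C" for q r
        using C that by (auto simp: Chains_def relation_of_def)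
      \<comment> \<open>The infimum along a chain is finite because every sublinear
        \<open>q \<le> p\<close> satisfies
        \<open>- p (- x) \<le> - q (- x) \<le> q x\<close>.\<close>
      have bdd: "bdd_below ((\<lambda>q. q x) ` C)" for x
      proof (rule bdd_belowI2)
        fix q assume "q \<in> C"
        then have "sublinear q" "q (- x) \<le> p (- x)" using CA by (auto simp: A_def le_fun_def)
        then show "- p (- x) \<le> q x" using sublinear_minus[of q x] by linarith
      qed
      have le: "(INF q\<in>C. q x) \<le> q x" if "q \<in> C" for q x
        by (rule cINF_lower[OF bdd that])
      have "sublinear (\<lambda>x. INF q\<in>C. q x)"
        using CA False chain bdd by (intro sublinear_Inf_chain) (auto simp: A_def)
      moreover from False obtain q where q: "q \<in> C" by blast
      then have "q \<le> p" using CA by (auto simp: A_def)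
      then have "(\<lambda>x. INF q\<in>C. q x) \<le> p"
        unfolding le_fun_def using le[OF q] by (blast intro: order_trans)
      ultimately show ?thesis
        using le by (intro bexI[of _ "\<lambda>x. INF q\<in>C. q x"]) (auto simp: A_def le_fun_def)
    qed
  qed
  then obtain m where m: "sublinear m" "m \<le> p"
    and min: "\<And>q. sublinear q \<Longrightarrow> q \<le> p \<Longrightarrow> q \<le> m \<Longrightarrow> q = m"
    by (auto simp: A_def)
  have "shifted m y = m" for y
  proof (rule min)
    show "sublinear (shifted m y)" by (rule sublinear_shifted[OF m(1)])
    show le: "shifted m y \<le> m" using shifted_le_self[OF m(1)] by (simp add: le_fun_def)
    show "shifted m y \<le> p" by (rule order_trans[OF le m(2)])
  qed
  then have add: "m (x + y) = m x + m y" for x y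
    using shifted_le[OF m(1), of 1 y x] sublinear_add[OF m(1), of x y] by simp
  have "m (- x) = - m x" for x
    using add[of x "- x"] by (simp add: sublinear_0[OF m(1)])
  then have "m (c *\<^sub>R x) = c * m x" for c x
    using sublinear_scaleR[OF m(1), of "\<bar>c\<bar>" x] sublinear_scaleR[OF m(1), of "\<bar>c\<bar>" "- x"]
    by (cases "0 \<le> c") auto
  with add have "linear m" by (intro linearI) auto
  with m show ?thesis by blast
qed

text \<open>A linear \<open>g\<close> below \<open>shifted p x0\<close> is also below
  \<open>p\<close>. The parameter \<open>t = 1\<close> at the point \<open>- x0\<close> gives
  \<open>g (- x0) \<le> p 0 - p x0\<close>, which is the missing inequality at
  \<open>x0\<close>.\<close>

theorem Hahn_Banach_at:
  fixes p :: "'a::real_vector \<Rightarrow> real"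
  assumes p: "sublinear p"
  obtains g where "linear g" "\<And>x. g x \<le> p x" "g x0 = p x0"
proof -
  obtain g where g: "linear g" "g \<le> shifted p x0"
    using ex_linear_le_sublinear[OF sublinear_shifted[OF p]] by blast
  have le: "g x \<le> p x" for x
    using g(2) shifted_le_self[OF p, of x0 x] by (auto simp: le_fun_def intro: order_trans)
  have "g (- x0) \<le> - p x0"
    using g(2) shifted_le[OF p, of 1 x0 "- x0"] sublinear_0[OF p]
    by (auto simp: le_fun_def intro: order_trans)
  then have "g x0 = p x0"
    using le[of x0] by (simp add: linear_neg[OF g(1)])
  with g(1) le show ?thesis by (rule that)
qed

lemma ex_norming_functional:
  fixes x :: "'a::real_normed_vector"
  obtains g :: "'a \<Rightarrow>\<^sub>L real" where "g x = norm x" "norm g \<le> 1"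
proof -
  have "sublinear (norm :: 'a \<Rightarrow> real)"
    by (simp add: sublinear_def norm_triangle_ineq)
  then obtain g where g: "linear g" "\<And>y. g y \<le> norm y" "g x = norm x"
    by (rule Hahn_Banach_at[of norm x]) blast
  have b: "\<bar>g y\<bar> \<le> norm y" for y
    using g(2)[of y] g(2)[of "- y"] by (simp add: linear_neg[OF g(1)])
  have "bounded_linear g"
    using g(1) b by (intro bounded_linear_intro[where K = 1])
      (auto simp: linear_add linear_scale)
  then have "blinfun_apply (Blinfun g) = g" by (rule bounded_linear_Blinfun_apply)
  then show ?thesis
    using g(3) b by (intro that[of "Blinfun g"]) (auto intro!: norm_blinfun_bound)
qed

text \<open>The closed sets \<open>F k\<close> cover a complete space, so by Baire's theorem one of
  them contains a ball. Differences of points of that ball reach every direction.\<close>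

lemma uniform_boundedness:
  fixes T :: "nat \<Rightarrow> 'a::banach \<Rightarrow>\<^sub>L 'b::real_normed_vector"
  assumes pw: "\<And>x. \<exists>M. \<forall>n. norm (T n x) \<le> M"
  obtains M where "\<And>n. norm (T n) \<le> M"
proof -
  define F where "F k = {x. \<forall>n. norm (T n x) \<le> real k}" for k
  have "closed (F k)" for k
    unfolding F_def
    by (intro closed_Collect_all closed_Collect_le continuous_intros)
  have U: "\<Union>(range F) = UNIV"
  proof (intro equalityI subset_UNIV subsetI)
    fix x
    obtain M where M: "\<forall>n. norm (T n x) \<le> M" using pw[of x] by (rule exE)
    obtain k where "M \<le> real k" using real_arch_simple by blast
    then have "x \<in> F k" using M by (auto simp: F_def intro: order_trans)
    then show "x \<in> \<Union>(range F)" by blast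
  qed
  have mc: "Met_TC.mcomplete TYPE('a)"
    by (simp add: mcomplete_iff_complete complete_UNIV)
  have "\<exists>k. interior (F k) \<noteq> {}"
  proof (rule ccontr)
    assume "\<not> ?thesis"
    then have "Met_TC.mtopology interior_of \<Union>(range F) = {}"
      using \<open>\<And>k. closed (F k)\<close> by (intro Met_TC.metric_Baire_category_alt[OF mc]) auto
    with U show False by simp
  qed
  then obtain k x0 where "x0 \<in> interior (F k)" by blast
  then obtain r where r: "r > 0" "ball x0 r \<subseteq> F k"
    using mem_interior by blast
  have "norm (T n) \<le> 4 * real k / r" for n
  proof (rule norm_blinfun_bound)
    show "0 \<le> 4 * real k / r" using r by simp
    fix x
    show "norm (T n x) \<le> 4 * real k / r * norm x"
    proof (cases "x = 0")
      case False
      \<comment> \<open>The scaled vector has norm \<open>r / 2\<close>, so \<open>x0\<close> and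
        \<open>x0 + c *\<^sub>R x\<close> both lie in the ball.\<close>
      define c where "c = r / (2 * norm x)"
      have c: "c > 0" using r False by (simp add: c_def)
      have "norm (c *\<^sub>R x) < r" using r False by (simp add: c_def)
      then have "x0 + c *\<^sub>R x \<in> F k" "x0 \<in> F k" using r by (auto simp: dist_norm subset_iff)
      then have "norm (T n (x0 + c *\<^sub>R x)) \<le> real k" "norm (T n x0) \<le> real k" by (auto simp: F_def)
      then have "norm (T n (c *\<^sub>R x)) \<le> 2 * real k"
        using norm_triangle_ineq4[of "T n (x0 + c *\<^sub>R x)" "T n x0"] by (simp add: blinfun.add_right)
      then have "c * norm (T n x) \<le> 2 * real k" using c by (simp add: blinfun.scaleR_right)
      then have "norm (T n x) \<le> 2 * real k / c" using c by (simp add: field_simps)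
      also have "\<dots> = 4 * real k / r * norm x" using r False by (simp add: c_def)
      finally show ?thesis .
    qed simp
  qed
  then show ?thesis by (rule that)
qed

text \<open>The vectors \<open>x n\<close> act by evaluation on the dual, which is a Banach space.
  Uniform boundedness bounds the evaluations \<open>T n\<close>, and a norming functional carries
  the bound back to \<open>x n\<close>.\<close>

lemma weakly_null_bounded:
  fixes x :: "nat \<Rightarrow> 'a::real_normed_vector"
  assumes "weakly_null x"
  shows "bounded (range x)"
proof -
  define T where "T n = Blinfun (\<lambda>\<phi> :: 'a \<Rightarrow>\<^sub>L real. \<phi> (x n))" for n
  have T: "T n \<phi> = \<phi> (x n)" for n \<phi>
    unfolding T_def by (subst bounded_linear_Blinfun_apply) (auto intro: blinfun.bounded_linear_left)
  have "\<exists>M. \<forall>n. norm (T n \<phi>) \<le> M" for \<phi>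
  proof -
    have "Bseq (\<lambda>n. \<phi> (x n))"
      using assms unfolding weakly_null_def by (intro convergent_imp_Bseq) (auto simp: convergent_def)
    then show ?thesis by (auto simp: T Bseq_def)
  qed
  then obtain M where M: "\<And>n. norm (T n) \<le> M"
    using uniform_boundedness[of T] by blast
  have "norm (x n) \<le> M" for n
  proof -
    obtain g :: "'a \<Rightarrow>\<^sub>L real" where g: "g (x n) = norm (x n)" "norm g \<le> 1"
      by (rule ex_norming_functional)
    have "norm (x n) = norm (T n g)" by (simp add: T g)
    also have "\<dots> \<le> norm (T n) * norm g" by (rule norm_blinfun)
    also have "\<dots> \<le> norm (T n) * 1" by (intro mult_left_mono g) simp
    finally show ?thesis using M[of n] by simp
  qed
  then show ?thesis by (auto simp: bounded_iff)
qed

subsection \<open>Disjointness and band seminorms\<close>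

lemma norm_abs_eq [simp]: "norm \<bar>x :: 'a::banach_lattice\<bar> = norm x"
  by (intro antisym norm_mono_abs) simp_all

lemma norm_mono_nonneg:
  fixes x y :: "'a::banach_lattice"
  shows "0 \<le> x \<Longrightarrow> x \<le> y \<Longrightarrow> norm x \<le> norm y"
  by (rule norm_mono_abs) (metis abs_of_nonneg order_trans)

text \<open>One inequality is proved for all scalars; the reverse one follows by applying it to
  \<open>inverse c\<close> and \<open>c *\<^sub>R x\<close>.\<close>

lemma abs_scaleR_lattice: "\<bar>c *\<^sub>R x\<bar> = \<bar>c\<bar> *\<^sub>R \<bar>x :: 'a::banach_lattice\<bar>"
proof -
  have le: "\<bar>c *\<^sub>R x\<bar> \<le> \<bar>c\<bar> *\<^sub>R \<bar>x\<bar>" for c and x :: 'a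
  proof (cases "0 \<le> c")
    case True
    then show ?thesis
      using scaleR_left_mono[OF abs_ge_self, of c x] scaleR_left_mono[OF abs_ge_minus_self, of c x]
      by (auto intro: abs_leI)
  next
    case False
    then show ?thesis
      using scaleR_left_mono[OF abs_ge_self, of "- c" x] scaleR_left_mono[OF abs_ge_minus_self, of "- c" x]
      by (auto intro: abs_leI)
  qed
  show ?thesis
  proof (cases "c = 0")
    case False
    have "\<bar>c\<bar> *\<^sub>R \<bar>x\<bar> = \<bar>c\<bar> *\<^sub>R \<bar>inverse c *\<^sub>R (c *\<^sub>R x)\<bar>" using False by simp
    also have "\<dots> \<le> \<bar>c\<bar> *\<^sub>R (\<bar>inverse c\<bar> *\<^sub>R \<bar>c *\<^sub>R x\<bar>)" by (intro scaleR_left_mono le) simp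
    also have "\<dots> = \<bar>c *\<^sub>R x\<bar>" using False by (simp add: abs_inverse)
    finally show ?thesis using le[of c x] by (rule antisym[rotated])
  qed simp
qed

text \<open>The first summand is \<open>z\<close> truncated to the interval from \<open>- a\<close>
  to \<open>a\<close>; the remainder is then computed explicitly and lies between \<open>- b\<close>
  and \<open>b\<close>.\<close>

lemma Riesz_decomposition:
  fixes z a b :: "'a::banach_lattice"
  assumes "\<bar>z\<bar> \<le> a + b" "0 \<le> a" "0 \<le> b"
  obtains u v where "z = u + v" "\<bar>u\<bar> \<le> a" "\<bar>v\<bar> \<le> b"
proof
  let ?u = "sup (- a) (inf z a)"
  have z: "z \<le> a + b" "- z \<le> a + b"
    using assms(1) abs_le_D1 abs_le_D2 by blast+
  have na: "- a \<le> a" using assms(2) by (meson neg_le_0_iff_le order_trans)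
  show "z = ?u + (z - ?u)" by (simp only: add.commute[of ?u] diff_add_cancel)
  show "\<bar>?u\<bar> \<le> a"
  proof (rule abs_leI)
    show "?u \<le> a" using na by (intro sup_least inf_le2)
    show "- ?u \<le> a" by (subst minus_le_iff) (rule sup_ge1)
  qed
  have "z - ?u = inf (z + a) (sup 0 (z - a))"
    by (simp only: diff_sup_eq_inf neg_inf_eq_sup add_inf_distrib_left add_sup_distrib_left
        minus_minus right_minus add_uminus_conv_diff)
  moreover have "inf (z + a) (sup 0 (z - a)) \<le> b"
    using z(1) assms(3) by (intro le_infI2 sup_least) (auto simp: algebra_simps)
  moreover have "- inf (z + a) (sup 0 (z - a)) \<le> b"
  proof (subst minus_le_iff, intro inf_greatest)
    show "- b \<le> z + a" using z(2)
      by (metis add.commute add_le_cancel_left diff_le_eq minus_add_distrib minus_le_iff uminus_add_conv_diff)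
    show "- b \<le> sup 0 (z - a)" using assms(3) by (intro le_supI1) simp
  qed
  ultimately show "\<bar>z - ?u\<bar> \<le> b" by (metis abs_leI)
qed

text \<open>The difference \<open>inf (a + b) c - inf b c\<close> is bounded both by
  \<open>a\<close> and by \<open>c\<close>.\<close>

lemma inf_add_le:
  fixes a b c :: "'a::lattice_ab_group_add"
  assumes "0 \<le> a" "0 \<le> b" "0 \<le> c"
  shows "inf (a + b) c \<le> inf a c + inf b c"
proof -
  have "inf (a + b) c - inf b c = sup (inf (a + b) c - b) (inf (a + b) c - c)"
    by (simp add: diff_inf_eq_sup add_sup_distrib_left)
  also have "\<dots> \<le> a"
  proof (rule sup_least)
    show "inf (a + b) c - b \<le> a" by (simp add: diff_le_eq)
    have "inf (a + b) c - c \<le> 0" by simp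
    then show "inf (a + b) c - c \<le> a" using assms(1) by (rule order_trans)
  qed
  finally have 1: "inf (a + b) c - inf b c \<le> a" .
  have "inf (a + b) c \<le> c + inf b c"
    using assms by (intro le_infI2) simp
  then have "inf (a + b) c - inf b c \<le> c" by (simp only: diff_le_eq)
  with 1 have "inf (a + b) c - inf b c \<le> inf a c" by (rule inf_greatest)
  then show ?thesis by (simp only: diff_le_eq)
qed

text \<open>For disjoint elements the sum of the moduli equals their supremum, so a common bound
  \<open>u\<close> survives each step of the induction. The auxiliary fact \<open>disj\<close> keeps
  a partial sum disjoint from the next term.\<close>

lemma abs_sum_disjoint:
  fixes z :: "'i \<Rightarrow> 'a::lattice_ab_group_add_abs"
  assumes "finite F" and "\<And>i j. i \<in> F \<Longrightarrow> j \<in> F \<Longrightarrow> i \<noteq> j \<Longrightarrow> inf \<bar>z i\<bar> \<bar>z j\<bar> = 0"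
    and "\<And>i. i \<in> F \<Longrightarrow> \<bar>z i\<bar> \<le> u" and u: "0 \<le> u"
  shows "\<bar>sum z F\<bar> \<le> u"
proof -
  have disj: "inf \<bar>sum z G\<bar> \<bar>w\<bar> = 0" if "finite G" "\<And>i. i \<in> G \<Longrightarrow> inf \<bar>z i\<bar> \<bar>w\<bar> = 0" for G w
    using that
  proof (induction G rule: finite_induct)
    case (insert i G)
    have "inf \<bar>z i + sum z G\<bar> \<bar>w\<bar> \<le> inf (\<bar>z i\<bar> + \<bar>sum z G\<bar>) \<bar>w\<bar>"
      by (intro inf_mono abs_triangle_ineq order_refl)
    also have "\<dots> \<le> inf \<bar>z i\<bar> \<bar>w\<bar> + inf \<bar>sum z G\<bar> \<bar>w\<bar>"
      by (rule inf_add_le) simp_all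
    also have "\<dots> = 0" using insert by simp
    finally show ?case using insert by (simp add: antisym)
  qed (simp add: inf_absorb1)
  show ?thesis using assms(1-3)
  proof (induction F rule: finite_induct)
    case (insert i G)
    have "inf \<bar>sum z G\<bar> \<bar>z i\<bar> = 0"
      using insert by (intro disj) (auto)
    then have "\<bar>sum z G\<bar> + \<bar>z i\<bar> = sup \<bar>sum z G\<bar> \<bar>z i\<bar>" by (subst add_eq_inf_sup) simp
    also have "\<dots> \<le> u" using insert by (intro sup_least) auto
    finally have "\<bar>z i + sum z G\<bar> \<le> u"
      using order_trans[OF abs_triangle_ineq[of "z i" "sum z G"]] by (metis add.commute)
    then show ?case using insert(1,2) by simp
  qed (simp add: u)
qed

lemma inf_le_scaleR_disjoint:
  fixes a b :: "'a::banach_lattice"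
  assumes "inf \<bar>a\<bar> \<bar>b\<bar> = 0" "\<bar>y\<bar> \<le> c *\<^sub>R \<bar>a\<bar>" "\<bar>z\<bar> \<le> d *\<^sub>R \<bar>b\<bar>"
  shows "inf \<bar>y\<bar> \<bar>z\<bar> = 0"
proof -
  \<comment> \<open>A common positive factor for both bounds; the \<open>1\<close> keeps it positive
    even if \<open>c\<close> and \<open>d\<close> are not.\<close>
  define m where "m = max 1 (max c d)"
  have m: "m > 0" "c \<le> m" "d \<le> m" by (auto simp: m_def)
  have "\<bar>y\<bar> \<le> m *\<^sub>R \<bar>a\<bar>" "\<bar>z\<bar> \<le> m *\<^sub>R \<bar>b\<bar>"
    using assms m scaleR_right_mono[OF m(2), of "\<bar>a\<bar>"] scaleR_right_mono[OF m(3), of "\<bar>b\<bar>"]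
    by (auto intro: order_trans)
  then have "inf \<bar>y\<bar> \<bar>z\<bar> \<le> m *\<^sub>R \<bar>a\<bar>" "inf \<bar>y\<bar> \<bar>z\<bar> \<le> m *\<^sub>R \<bar>b\<bar>"
    by (auto intro: le_infI1 le_infI2)
  then have "inverse m *\<^sub>R inf \<bar>y\<bar> \<bar>z\<bar> \<le> inf \<bar>a\<bar> \<bar>b\<bar>"
    using m scaleR_left_mono[of "inf \<bar>y\<bar> \<bar>z\<bar>" _ "inverse m"] by (intro inf_greatest) fastforce+
  then have "m *\<^sub>R (inverse m *\<^sub>R inf \<bar>y\<bar> \<bar>z\<bar>) \<le> m *\<^sub>R 0"
    using m assms by (intro scaleR_left_mono) auto
  then show ?thesis using m by (simp add: antisym)
qed

text \<open>On \<open>x \<ge> 0\<close> this is \<open>\<bar>f\<bar> (P x)\<close> with \<open>P\<close> the projection onto the band generated by \<open>y\<close>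
  in the bidual; the supremum avoids constructing \<open>\<bar>f\<bar>\<close> and \<open>P\<close>.\<close>

definition band_seminorm :: "('a::banach_lattice \<Rightarrow>\<^sub>L real) \<Rightarrow> 'a \<Rightarrow> 'a \<Rightarrow> real" where
  "band_seminorm f y x = Sup {f z | z. \<bar>z\<bar> \<le> \<bar>x\<bar> \<and> (\<exists>c. \<bar>z\<bar> \<le> c *\<^sub>R \<bar>y\<bar>)}"

lemma blinfun_le_norm_mult:
  fixes f :: "'a::banach_lattice \<Rightarrow>\<^sub>L real"
  assumes "\<bar>z\<bar> \<le> \<bar>x\<bar>"
  shows "f z \<le> norm f * norm x"
proof -
  have "f z \<le> norm (f z)" by simp
  also have "\<dots> \<le> norm f * norm z" by (rule norm_blinfun)
  also have "\<dots> \<le> norm f * norm x" by (intro mult_left_mono norm_mono_abs assms) simp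
  finally show ?thesis .
qed

lemma band_seminorm_bdd_above:
  fixes f :: "'a::banach_lattice \<Rightarrow>\<^sub>L real"
  shows "bdd_above {f z | z. \<bar>z\<bar> \<le> \<bar>x\<bar> \<and> (\<exists>c. \<bar>z\<bar> \<le> c *\<^sub>R \<bar>y\<bar>)}"
  by (rule bdd_aboveI[where M = "norm f * norm x"]) (auto intro: blinfun_le_norm_mult)

lemma band_seminorm_nonempty:
  "{f z | z. \<bar>z\<bar> \<le> \<bar>x\<bar> \<and> (\<exists>c. \<bar>z\<bar> \<le> c *\<^sub>R \<bar>y :: 'a::banach_lattice\<bar>)} \<noteq> {}"
proof -
  have "\<bar>0::'a\<bar> \<le> \<bar>x\<bar>" "\<bar>0::'a\<bar> \<le> 0 *\<^sub>R \<bar>y\<bar>" by auto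
  then show ?thesis by blast
qed

lemma band_seminorm_upper:
  fixes f :: "'a::banach_lattice \<Rightarrow>\<^sub>L real"
  assumes "\<bar>z\<bar> \<le> \<bar>x\<bar>" "\<bar>z\<bar> \<le> c *\<^sub>R \<bar>y\<bar>"
  shows "f z \<le> band_seminorm f y x"
  unfolding band_seminorm_def using assms by (intro cSup_upper band_seminorm_bdd_above) blast

lemma band_seminorm_least:
  fixes f :: "'a::banach_lattice \<Rightarrow>\<^sub>L real"
  assumes "\<And>z c. \<bar>z\<bar> \<le> \<bar>x\<bar> \<Longrightarrow> \<bar>z\<bar> \<le> c *\<^sub>R \<bar>y\<bar> \<Longrightarrow> f z \<le> B"
  shows "band_seminorm f y x \<le> B"
  unfolding band_seminorm_def using assms by (intro cSup_least band_seminorm_nonempty) blast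

lemma band_seminorm_minus: "band_seminorm f y (- x) = band_seminorm f y x"
  by (simp add: band_seminorm_def)

lemma abs_le_band_seminorm:
  fixes f :: "'a::banach_lattice \<Rightarrow>\<^sub>L real"
  assumes "\<bar>y\<bar> \<le> \<bar>x\<bar>"
  shows "\<bar>f y\<bar> \<le> band_seminorm f y x"
  using band_seminorm_upper[of y x 1 y f] band_seminorm_upper[of "- y" x 1 y f] assms
  by (auto simp: blinfun.minus_right)

text \<open>Subadditivity is Riesz decomposition of the competitor \<open>z\<close> for
  \<open>a + b\<close>. For homogeneity one inequality suffices, used once for \<open>c\<close> and
  once for \<open>inverse c\<close>.\<close>

lemma sublinear_band_seminorm: "sublinear (band_seminorm f y)"
  unfolding sublinear_def
proof (intro conjI allI impI)
  fix a b
  show "band_seminorm f y (a + b) \<le> band_seminorm f y a + band_seminorm f y b"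
  proof (rule band_seminorm_least)
    fix z c assume z: "\<bar>z\<bar> \<le> \<bar>a + b\<bar>" "\<bar>z\<bar> \<le> c *\<^sub>R \<bar>y\<bar>"
    have "\<bar>z\<bar> \<le> \<bar>a\<bar> + \<bar>b\<bar>" using z(1) abs_triangle_ineq by (rule order_trans)
    \<comment> \<open>Cutting the bounds down by \<open>\<bar>z\<bar>\<close> ensures that both
      parts of \<open>z\<close> are again dominated by
      \<open>c *\<^sub>R \<bar>y\<bar>\<close>.\<close>
    then have "\<bar>z\<bar> = inf (\<bar>a\<bar> + \<bar>b\<bar>) \<bar>z\<bar>" by (simp add: inf_absorb2)
    also have "\<dots> \<le> inf \<bar>a\<bar> \<bar>z\<bar> + inf \<bar>b\<bar> \<bar>z\<bar>" by (rule inf_add_le) simp_all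
    finally obtain u v where uv: "z = u + v" "\<bar>u\<bar> \<le> inf \<bar>a\<bar> \<bar>z\<bar>" "\<bar>v\<bar> \<le> inf \<bar>b\<bar> \<bar>z\<bar>"
      by (rule Riesz_decomposition) simp_all
    then have "f u \<le> band_seminorm f y a" "f v \<le> band_seminorm f y b"
      using z(2) by (auto intro!: band_seminorm_upper[where c = c] intro: order_trans)
    then show "f z \<le> band_seminorm f y a + band_seminorm f y b"
      by (simp add: uv(1) blinfun.add_right)
  qed
next
  fix c :: real and x assume c0: "0 \<le> c"
  have le: "band_seminorm f y (c *\<^sub>R x) \<le> c * band_seminorm f y x" if c: "c > 0" for c x
  proof (rule band_seminorm_least)
    fix z d assume z: "\<bar>z\<bar> \<le> \<bar>c *\<^sub>R x\<bar>" "\<bar>z\<bar> \<le> d *\<^sub>R \<bar>y\<bar>"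
    have "\<bar>inverse c *\<^sub>R z\<bar> \<le> \<bar>x\<bar>" "\<bar>inverse c *\<^sub>R z\<bar> \<le> (inverse c * d) *\<^sub>R \<bar>y\<bar>"
      using c scaleR_left_mono[OF z(1), of "inverse c"] scaleR_left_mono[OF z(2), of "inverse c"]
      by (simp_all add: abs_scaleR_lattice)
    then have "f (inverse c *\<^sub>R z) \<le> band_seminorm f y x" by (rule band_seminorm_upper)
    then show "f z \<le> c * band_seminorm f y x"
      using c by (simp add: blinfun.scaleR_right field_simps)
  qed
  show "band_seminorm f y (c *\<^sub>R x) = c * band_seminorm f y x"
  proof (cases "c = 0")
    case True
    have "band_seminorm f y 0 \<le> 0"
      by (rule band_seminorm_least) simp
    moreover have "0 \<le> band_seminorm f y 0"
      using band_seminorm_upper[of 0 0 0 y f] by simp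
    ultimately show ?thesis using True by simp
  next
    case False
    with c0 have c: "c > 0" by simp
    have "band_seminorm f y x \<le> inverse c * band_seminorm f y (c *\<^sub>R x)"
      using le[of "inverse c" "c *\<^sub>R x"] c by simp
    then show ?thesis using le[OF c, of x] c by (simp add: field_simps)
  qed
qed

text \<open>After changes of sign the left side is the value of \<open>f\<close> at a single vector,
  a sum of disjoint elements, whose modulus is at most \<open>\<bar>u\<bar>\<close>.\<close>

lemma sum_abs_disjoint_le:
  fixes z :: "'i \<Rightarrow> 'a::banach_lattice" and f :: "'a \<Rightarrow>\<^sub>L real"
  assumes F: "finite F" and disj: "\<And>i j. i \<in> F \<Longrightarrow> j \<in> F \<Longrightarrow> i \<noteq> j \<Longrightarrow> inf \<bar>z i\<bar> \<bar>z j\<bar> = 0"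
    and le: "\<And>i. i \<in> F \<Longrightarrow> \<bar>z i\<bar> \<le> \<bar>u\<bar>"
  shows "(\<Sum>i\<in>F. \<bar>f (z i)\<bar>) \<le> norm f * norm u"
proof -
  define w where "w i = (if f (z i) \<ge> 0 then z i else - z i)" for i
  have aw: "\<bar>w i\<bar> = \<bar>z i\<bar>" for i by (simp add: w_def)
  have "(\<Sum>i\<in>F. \<bar>f (z i)\<bar>) = (\<Sum>i\<in>F. f (w i))"
    by (rule sum.cong) (auto simp: w_def blinfun.minus_right)
  also have "\<dots> = f (\<Sum>i\<in>F. w i)" by (simp add: blinfun.sum_right)
  also have "\<dots> \<le> norm f * norm u"
    by (rule blinfun_le_norm_mult, rule abs_sum_disjoint[OF F]) (use disj le aw in auto)
  finally show ?thesis .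
qed

text \<open>Near-maximisers \<open>z k\<close> for the separate seminorms are dominated by multiples
  of the disjoint \<open>y k\<close>, so they are disjoint themselves and all lie below
  \<open>\<bar>x\<bar>\<close>.\<close>

lemma sum_band_seminorm_le:
  fixes y :: "nat \<Rightarrow> 'a::banach_lattice"
  assumes "disjoint_seq y"
  shows "(\<Sum>k<N. band_seminorm f (y k) x) \<le> norm f * norm x"
proof (rule field_le_epsilon)
  fix e :: real assume e: "e > 0"
  define d where "d = e / (real N + 1)"
  have d: "d > 0" using e by (simp add: d_def)
  have "\<exists>z c. \<bar>z\<bar> \<le> \<bar>x\<bar> \<and> \<bar>z\<bar> \<le> c *\<^sub>R \<bar>y k\<bar> \<and> band_seminorm f (y k) x - d < f z" for k
    using less_cSupD[OF band_seminorm_nonempty, of "band_seminorm f (y k) x - d" f x "y k"] d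
    by (auto simp: band_seminorm_def)
  then obtain z c where z: "\<And>k. \<bar>z k\<bar> \<le> \<bar>x\<bar>" "\<And>k. \<bar>z k\<bar> \<le> c k *\<^sub>R \<bar>y k\<bar>"
    "\<And>k. band_seminorm f (y k) x - d < f (z k)" by metis
  have "(\<Sum>k<N. band_seminorm f (y k) x) \<le> (\<Sum>k<N. \<bar>f (z k)\<bar> + d)"
    using z(3) by (intro sum_mono) (smt (verit))
  also have "\<dots> = (\<Sum>k<N. \<bar>f (z k)\<bar>) + real N * d" by (simp add: sum.distrib)
  also have "\<dots> \<le> norm f * norm x + e"
  proof (rule add_mono)
    show "(\<Sum>k<N. \<bar>f (z k)\<bar>) \<le> norm f * norm x"
    proof (rule sum_abs_disjoint_le)
      fix i j :: nat assume "i \<noteq> j"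
      then have "inf \<bar>y i\<bar> \<bar>y j\<bar> = 0" using assms by (simp add: disjoint_seq_def)
      then show "inf \<bar>z i\<bar> \<bar>z j\<bar> = 0" by (rule inf_le_scaleR_disjoint) (rule z)+
    qed (auto intro: z)
    show "real N * d \<le> e" using e by (simp add: d_def field_simps)
  qed
  finally show "(\<Sum>k<N. band_seminorm f (y k) x) \<le> norm f * norm x + e" .
qed

subsection \<open>Weakly null sequences and disjointness\<close>

text \<open>This is the Schur property of \<open>l\<^sup>1\<close>: only the functionals that sum over a subset \<open>S\<close> are tested.\<close>

lemma gliding_hump:
  fixes a :: "nat \<Rightarrow> nat \<Rightarrow> real"
  assumes summ: "\<And>n. summable (\<lambda>k. \<bar>a n k\<bar>)"
    and null: "\<And>S. (\<lambda>n. \<Sum>k. if k \<in> S then a n k else 0) \<longlonglongrightarrow> 0"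
    and e: "e > 0"
  shows "\<exists>n. a n n < e"
proof (rule ccontr)
  assume "\<nexists>n. a n n < e"
  then have diag: "e \<le> a n n" for n by (simp add: not_less)
  have coord: "(\<lambda>n. \<bar>a n k\<bar>) \<longlonglongrightarrow> 0" for k
  proof -
    have "(\<Sum>j. if j \<in> {k} then a n j else 0) = a n k" for n
      by (subst suminf_finite[where N = "{k}"]) auto
    then show ?thesis using null[of "{k}"] by (simp add: tendsto_rabs_zero)
  qed
  have head: "\<exists>n\<ge>m. (\<Sum>k<m. \<bar>a n k\<bar>) < e / 4" for m
  proof -
    have "(\<lambda>n. \<Sum>k<m. \<bar>a n k\<bar>) \<longlonglongrightarrow> (\<Sum>k<m. 0)" by (intro tendsto_sum coord)
    then have "\<forall>\<^sub>F n in sequentially. (\<Sum>k<m. \<bar>a n k\<bar>) < e / 4"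
      using e by (intro order_tendstoD(2)[of _ 0]) auto
    then obtain N where "\<And>n. n \<ge> N \<Longrightarrow> (\<Sum>k<m. \<bar>a n k\<bar>) < e / 4"
      by (auto simp: eventually_sequentially)
    then show ?thesis by (intro exI[of _ "max m N"]) auto
  qed
  have tail: "\<exists>m>n. (\<Sum>k. \<bar>a n (k + m)\<bar>) < e / 4" for n
  proof -
    have "(\<lambda>m. \<Sum>k. \<bar>a n (k + m)\<bar>) \<longlonglongrightarrow> 0" by (rule suminf_exist_split2[OF summ])
    then have "\<forall>\<^sub>F m in sequentially. (\<Sum>k. \<bar>a n (k + m)\<bar>) < e / 4"
      using e by (intro order_tendstoD(2)[of _ 0]) auto
    then obtain N where "\<And>m. m \<ge> N \<Longrightarrow> (\<Sum>k. \<bar>a n (k + m)\<bar>) < e / 4"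
      by (auto simp: eventually_sequentially)
    then show ?thesis by (intro exI[of _ "max (Suc n) N"]) auto
  qed
  obtain h where h: "\<And>m. h m \<ge> m" "\<And>m. (\<Sum>k<m. \<bar>a (h m) k\<bar>) < e / 4"
    using head by metis
  obtain t where t: "\<And>n. t n > n" "\<And>n. (\<Sum>k. \<bar>a n (k + t n)\<bar>) < e / 4"
    using tail by metis
  \<comment> \<open>The row after \<open>r j\<close> is chosen past \<open>t (r j)\<close>, where
    the tail of row \<open>r j\<close> is already small, and so that its own entries before
    \<open>t (r j)\<close> are small in sum.\<close>
  define r where "r = rec_nat (h 0) (\<lambda>_ n. h (t n))"
  have r0: "r 0 = h 0" and rS: "r (Suc j) = h (t (r j))" for j by (simp_all add: r_def)
  have rt: "t (r j) \<le> r (Suc j)" for j by (simp add: rS h)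
  then have mono: "strict_mono r"
    using t(1) by (intro strict_monoI_Suc) (metis less_le_trans)
  define S where "S = range r"
  \<comment> \<open>Between \<open>t (r j)\<close> and \<open>t (r (Suc j))\<close> the set
    \<open>S\<close> contains only the diagonal index, which contributes at least \<open>e\<close>.
    The head and the tail of the row each cost less than \<open>e / 4\<close>.\<close>
  have "e / 2 \<le> (\<Sum>k. if k \<in> S then a (r (Suc j)) k else 0)" for j
  proof -
    let ?n = "r (Suc j)" and ?m = "t (r j)" and ?M = "t (r (Suc j))"
    let ?b = "\<lambda>k. if k \<in> S then a ?n k else 0"
    have sb: "summable (\<lambda>k. \<bar>?b k\<bar>)"
      by (rule summable_comparison_test'[OF summ[of ?n], of 0]) auto
    have mM: "?m \<le> ?n" "?n < ?M" using rt t by auto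
    have gap: "?b k = 0" if "k \<in> {?m..<?M} - {?n}" for k
    proof -
      have "k \<notin> S"
      proof
        assume "k \<in> S"
        then obtain i where i: "k = r i" by (auto simp: S_def)
        consider "i \<le> j" | "i = Suc j" | "Suc (Suc j) \<le> i" by linarith
        then show False
        proof cases
          case 1
          then have "r i \<le> r j" by (rule monoD[OF strict_mono_mono[OF mono]])
          with that i t(1)[of "r j"] show False by auto
        next
          case 2 with that i show False by auto
        next
          case 3
          then have "r (Suc (Suc j)) \<le> r i" by (rule monoD[OF strict_mono_mono[OF mono]])
          with that i rt[of "Suc j"] show False by auto
        qed
      qed
      then show ?thesis by simp
    qed
    have "(\<Sum>k. ?b k) = (\<Sum>k. ?b (k + ?M)) + (\<Sum>k<?M. ?b k)"
      by (rule suminf_split_initial_segment) (rule summable_rabs_cancel[OF sb])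
    moreover have "\<bar>\<Sum>k. ?b (k + ?M)\<bar> \<le> (\<Sum>k. \<bar>a ?n (k + ?M)\<bar>)"
    proof -
      have "\<bar>\<Sum>k. ?b (k + ?M)\<bar> \<le> (\<Sum>k. \<bar>?b (k + ?M)\<bar>)"
        using summable_ignore_initial_segment[OF sb, of ?M] by (intro summable_rabs) simp
      also have "\<dots> \<le> (\<Sum>k. \<bar>a ?n (k + ?M)\<bar>)"
        using summable_ignore_initial_segment[OF sb, of ?M] summable_ignore_initial_segment[OF summ, of ?n ?M]
        by (intro suminf_le) auto
      finally show ?thesis .
    qed
    moreover have "(\<Sum>k<?M. ?b k) = (\<Sum>k<?m. ?b k) + a ?n ?n"
    proof -
      have "(\<Sum>k<?M. ?b k) = (\<Sum>k<?m. ?b k) + (\<Sum>k=?m..<?M. ?b k)"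
        using mM by (intro sum.atLeastLessThan_concat[of 0, symmetric, simplified atLeast0LessThan]) auto
      also have "(\<Sum>k=?m..<?M. ?b k) = (\<Sum>k\<in>{?n}. ?b k)"
        using mM gap by (intro sum.mono_neutral_right) auto
      finally show ?thesis by (simp add: S_def)
    qed
    moreover have "\<bar>\<Sum>k<?m. ?b k\<bar> \<le> (\<Sum>k<?m. \<bar>a ?n k\<bar>)"
      by (rule order_trans[OF sum_abs sum_mono]) auto
    ultimately show ?thesis
      using diag[of ?n] t(2)[of ?n] h(2)[of ?m, folded rS] by linarith
  qed
  moreover have "(\<lambda>j. \<Sum>k. if k \<in> S then a (r (Suc j)) k else 0) \<longlonglongrightarrow> 0"
  proof -
    have "strict_mono (\<lambda>j. r (Suc j))" using mono by (auto simp: strict_mono_def)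
    then show ?thesis using LIMSEQ_subseq_LIMSEQ[OF null[of S]] by (simp add: o_def)
  qed
  ultimately have "e / 2 \<le> 0" by (intro LIMSEQ_le_const) auto
  with e show False by simp
qed

text \<open>If \<open>h\<close> does not tend to zero, some infinite \<open>K\<close> has
  \<open>\<bar>h\<bar>\<close> bounded away from zero. Either \<open>n\<close> is constant on an
  infinite subset of \<open>K\<close>, or it takes each value finitely often there and tends to
  infinity along \<open>K\<close>. This handles index maps \<open>n\<close> over which there is no
  control.\<close>

lemma tendsto_0_dichotomy:
  fixes h :: "nat \<Rightarrow> real" and n :: "nat \<Rightarrow> nat"
  assumes const: "\<And>r m. strict_mono r \<Longrightarrow> (\<And>k. n (r k) = m) \<Longrightarrow> (\<lambda>k. h (r k)) \<longlonglongrightarrow> 0"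
    and top: "\<And>r. strict_mono r \<Longrightarrow> filterlim (\<lambda>k. n (r k)) at_top sequentially \<Longrightarrow>
      \<forall>e>0. \<exists>k. \<bar>h (r k)\<bar> < e"
  shows "h \<longlonglongrightarrow> 0"
proof (rule ccontr)
  assume "\<not> h \<longlonglongrightarrow> 0"
  then obtain e where e: "e > 0" and ev: "\<not> (\<forall>\<^sub>F k in sequentially. \<bar>h k\<bar> < e)"
    by (auto simp: tendsto_iff)
  define K where "K = {k. e \<le> \<bar>h k\<bar>}"
  have inf: "infinite K"
  proof
    assume "finite K"
    then obtain N where N: "\<And>k. k \<in> K \<Longrightarrow> k < N" using finite_nat_set_iff_bounded by metis
    have "\<forall>\<^sub>F k in sequentially. \<bar>h k\<bar> < e"
      unfolding eventually_sequentially by (rule exI[of _ N]) (use N in \<open>force simp: K_def not_le\<close>)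
    with ev show False by blast
  qed
  show False
  proof (cases "\<exists>m. infinite {k\<in>K. n k = m}")
    case True
    then obtain m where m: "infinite {k\<in>K. n k = m}" by blast
    let ?r = "enumerate {k\<in>K. n k = m}"
    have r: "?r k \<in> {k\<in>K. n k = m}" for k using m by (rule enumerate_in_set)
    have "(\<lambda>k. \<bar>h (?r k)\<bar>) \<longlonglongrightarrow> 0"
      using const[OF strict_mono_enumerate[OF m], of m] r by (simp add: tendsto_rabs_zero)
    then have "e \<le> 0" using r by (intro LIMSEQ_le_const) (auto simp: K_def)
    with e show False by simp
  next
    case False
    let ?r = "enumerate K"
    have r: "?r k \<in> K" for k using inf by (rule enumerate_in_set)
    have "filterlim (\<lambda>k. n (?r k)) at_top sequentially"
      unfolding filterlim_at_top
    proof
      fix Z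
      have "finite (\<Union>m<Z. {k\<in>K. n k = m})" using False by blast
      then have "\<exists>N. \<forall>k\<in>(\<Union>m<Z. {k\<in>K. n k = m}). k < N"
        by (simp only: finite_nat_set_iff_bounded)
      then obtain N where N: "\<And>k. k \<in> (\<Union>m<Z. {k\<in>K. n k = m}) \<Longrightarrow> k < N" by blast
      have "Z \<le> n (?r k)" if "k \<ge> N" for k
      proof (rule ccontr)
        assume "\<not> Z \<le> n (?r k)"
        then have "?r k < N" using r[of k] by (intro N) auto
        moreover have "k \<le> ?r k" by (rule le_enumerate[OF inf])
        ultimately show False using that by simp
      qed
      then show "\<forall>\<^sub>F k in sequentially. Z \<le> n (?r k)" by (auto simp: eventually_sequentially)
    qed
    then obtain k where "\<bar>h (?r k)\<bar> < e"
      using top[OF strict_mono_enumerate[OF inf]] e by blast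
    with r[of k] show False by (simp add: K_def)
  qed
qed

lemma weakly_null_compose:
  "weakly_null x \<Longrightarrow> filterlim r at_top sequentially \<Longrightarrow> weakly_null (\<lambda>k. x (r k))"
  unfolding weakly_null_def using filterlim_compose by blast

lemma disjoint_seq_subseq:
  "disjoint_seq x \<Longrightarrow> strict_mono r \<Longrightarrow> disjoint_seq (\<lambda>k. x (r k))"
  unfolding disjoint_seq_def by (simp add: strict_mono_eq)

lemma disjoint_order_bounded_weakly_null:
  assumes "disjoint_seq y" "\<And>k. \<bar>y k\<bar> \<le> \<bar>u\<bar>"
  shows "weakly_null y"
  unfolding weakly_null_def
proof
  fix f :: "'a \<Rightarrow>\<^sub>L real"
  have "summable (\<lambda>k. \<bar>f (y k)\<bar>)"
  proof (rule summableI_nonneg_bounded[where x = "norm f * norm u"])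
    show "(\<Sum>k<n. \<bar>f (y k)\<bar>) \<le> norm f * norm u" for n
      using assms by (intro sum_abs_disjoint_le) (auto simp: disjoint_seq_def)
  qed simp
  then show "(\<lambda>k. f (y k)) \<longlonglongrightarrow> 0"
    by (rule summable_LIMSEQ_zero[OF summable_rabs_cancel])
qed

text \<open>The functionals \<open>g k\<close> norm \<open>x k\<close> for the band seminorms, and
  \<open>\<bar>f (y k)\<bar> \<le> g k (x k)\<close>. The gliding hump applies to the matrix
  \<open>g k (x n)\<close>: its rows are absolutely summable, and each subset sum is a bounded
  functional evaluated along \<open>x\<close>.\<close>

lemma disjoint_dominated_not_bounded_below:
  fixes x y :: "nat \<Rightarrow> 'a::banach_lattice" and f :: "'a \<Rightarrow>\<^sub>L real"
  assumes x: "weakly_null x" and y: "disjoint_seq y" and le: "\<And>k. \<bar>y k\<bar> \<le> \<bar>x k\<bar>" and e: "e > 0"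
  shows "\<exists>k. \<bar>f (y k)\<bar> < e"
proof -
  have "\<exists>g. linear g \<and> (\<forall>z. g z \<le> band_seminorm f (y k) z) \<and> g (x k) = band_seminorm f (y k) (x k)" for k
    by (rule Hahn_Banach_at[OF sublinear_band_seminorm[of f "y k"], of "x k"]) blast
  then obtain g where g: "\<And>k. linear (g k)" "\<And>k z. g k z \<le> band_seminorm f (y k) z"
    "\<And>k. g k (x k) = band_seminorm f (y k) (x k)"
    by metis
  have g_abs: "\<bar>g k z\<bar> \<le> band_seminorm f (y k) z" for k z
    using g(2)[of k z] g(2)[of k "- z"] by (simp add: linear_neg[OF g(1)] band_seminorm_minus)
  have part: "(\<Sum>k<N. \<bar>g k z\<bar>) \<le> norm f * norm z" for N z
    using sum_mono[OF g_abs] sum_band_seminorm_le[OF y] by (rule order_trans)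
  have summ: "summable (\<lambda>k. \<bar>g k z\<bar>)" for z
    using part by (intro summableI_nonneg_bounded) auto
  have "\<exists>n. g n (x n) < e"
  proof (rule gliding_hump[of "\<lambda>n k. g k (x n)", OF summ _ e])
    fix S :: "nat set"
    define \<phi> where "\<phi> z = (\<Sum>k. if k \<in> S then g k z else 0)" for z
    have sS: "summable (\<lambda>k. \<bar>if k \<in> S then g k z else 0\<bar>)" for z
      by (rule summable_comparison_test'[OF summ[of z], of 0]) auto
    note sS' = summable_rabs_cancel[OF sS]
    have "bounded_linear \<phi>"
    proof (rule bounded_linear_intro[where K = "norm f"])
      fix a b :: 'a and c :: real
      show "\<phi> (a + b) = \<phi> a + \<phi> b"
        unfolding \<phi>_def by (subst suminf_add[OF sS' sS']) (auto simp: linear_add[OF g(1)] intro!: suminf_cong)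
      show "\<phi> (c *\<^sub>R a) = c *\<^sub>R \<phi> a"
        unfolding \<phi>_def real_scaleR_def
        by (subst suminf_mult[OF sS', symmetric]) (auto simp: linear_scale[OF g(1)] intro!: suminf_cong)
      have "\<bar>\<phi> a\<bar> \<le> (\<Sum>k. \<bar>if k \<in> S then g k a else 0\<bar>)"
        unfolding \<phi>_def by (rule summable_rabs[OF sS])
      also have "\<dots> \<le> (\<Sum>k. \<bar>g k a\<bar>)" by (intro suminf_le sS summ) auto
      also have "\<dots> \<le> norm f * norm a" by (rule suminf_le_const[OF summ part])
      finally show "norm (\<phi> a) \<le> norm a * norm f" by (simp add: mult.commute)
    qed
    then have "blinfun_apply (Blinfun \<phi>) = \<phi>" by (rule bounded_linear_Blinfun_apply)
    moreover have "(\<lambda>n. Blinfun \<phi> (x n)) \<longlonglongrightarrow> 0"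
      using x unfolding weakly_null_def by (rule spec)
    ultimately show "(\<lambda>n. \<Sum>k. if k \<in> S then g k (x n) else 0) \<longlonglongrightarrow> 0"
      by (simp add: \<phi>_def)
  qed
  then obtain n where "g n (x n) < e" by blast
  then have "\<bar>f (y n)\<bar> < e"
    using abs_le_band_seminorm[OF le[of n], of f] by (simp add: g(3))
  then show ?thesis by blast
qed

text \<open>A disjoint \<open>y\<close> in the solid hull satisfies
  \<open>\<bar>y k\<bar> \<le> \<bar>x (n k)\<bar>\<close> for some index map \<open>n\<close>.
  Where \<open>n\<close> is constant, \<open>y\<close> is order bounded; where \<open>n\<close>
  tends to infinity, the dominating sequence is weakly null.\<close>

lemma weakly_null_disjointly_weakly_compact:
  fixes x :: "nat \<Rightarrow> 'a::banach_lattice"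
  assumes x: "weakly_null x"
  shows "disjointly_weakly_compact (range x)"
  unfolding disjointly_weakly_compact_def
proof (intro conjI allI impI)
  show "bounded (range x)" by (rule weakly_null_bounded[OF x])
  fix y assume "range y \<subseteq> Sol (range x) \<and> disjoint_seq y"
  then have y: "disjoint_seq y" and "\<And>k. \<exists>n. \<bar>y k\<bar> \<le> \<bar>x n\<bar>" by (auto simp: Sol_def subset_iff)
  then obtain n where n: "\<And>k. \<bar>y k\<bar> \<le> \<bar>x (n k)\<bar>" by metis
  show "weakly_null y"
    unfolding weakly_null_def
  proof
    fix f :: "'a \<Rightarrow>\<^sub>L real"
    show "(\<lambda>k. f (y k)) \<longlonglongrightarrow> 0"
    proof (rule tendsto_0_dichotomy[of n])
      fix r :: "nat \<Rightarrow> nat" and m assume r: "strict_mono r" "\<And>k. n (r k) = m"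
      have "weakly_null (\<lambda>k. y (r k))"
        using n[of "r _"] r(2)
        by (intro disjoint_order_bounded_weakly_null[of _ "x m"] disjoint_seq_subseq[OF y r(1)]) metis
      then show "(\<lambda>k. f (y (r k))) \<longlonglongrightarrow> 0" by (simp add: weakly_null_def)
    next
      fix r :: "nat \<Rightarrow> nat" assume r: "strict_mono r" "filterlim (\<lambda>k. n (r k)) at_top sequentially"
      show "\<forall>e>0. \<exists>k. \<bar>f (y (r k))\<bar> < e"
        using disjoint_dominated_not_bounded_below[OF weakly_null_compose[OF x r(2)] disjoint_seq_subseq[OF y r(1)] n]
        by blast
    qed
  qed
qed

lemma order_bounded_disjointly_weakly_compact:
  assumes "order_bounded (A :: 'a::banach_lattice set)"
  shows "disjointly_weakly_compact A"
proof -
  obtain a b where ab: "A \<subseteq> {a..b}" using assms by (auto simp: order_bounded_def)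
  define u where "u = \<bar>a\<bar> + \<bar>b\<bar>"
  have le: "\<bar>x\<bar> \<le> \<bar>u\<bar>" if "x \<in> A" for x
  proof -
    have "a \<le> x" "x \<le> b" using ab that by auto
    moreover have "b \<le> u" using abs_ge_self[of b] by (simp add: u_def add_increasing)
    moreover have "- a \<le> u" using abs_ge_minus_self[of a] by (simp add: u_def add_increasing2)
    ultimately have "\<bar>x\<bar> \<le> u" by (intro abs_leI) (meson order_trans neg_le_iff_le)+
    then show ?thesis using abs_ge_self order_trans by blast
  qed
  show ?thesis
    unfolding disjointly_weakly_compact_def
  proof (intro conjI allI impI)
    show "bounded A" using le norm_mono_abs by (auto simp: bounded_iff)
    fix x assume x: "range x \<subseteq> Sol A \<and> disjoint_seq x"
    have "\<bar>x k\<bar> \<le> \<bar>u\<bar>" for k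
    proof -
      have "x k \<in> Sol A" using x by auto
      then show ?thesis using le by (auto simp: Sol_def intro: order_trans)
    qed
    with x show "weakly_null x" by (blast intro: disjoint_order_bounded_weakly_null)
  qed
qed

subsection \<open>Approximation by order intervals\<close>

lemma Sol_mono_abs: "x \<in> Sol A \<Longrightarrow> \<bar>y\<bar> \<le> \<bar>x\<bar> \<Longrightarrow> y \<in> Sol A"
  unfolding Sol_def by (blast intro: order_trans)

lemma bounded_Sol: "bounded A \<Longrightarrow> bounded (Sol A)"
  unfolding bounded_iff Sol_def by (blast intro: norm_mono_abs order_trans)

lemma subset_Sol: "A \<subseteq> Sol A"
  by (auto simp: Sol_def)

text \<open>The positive part of \<open>- l\<close> is dominated by
  \<open>\<bar>x n - l\<bar>\<close>, so its norm is zero.\<close>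

lemma nonneg_LIMSEQ:
  fixes x :: "nat \<Rightarrow> 'a::banach_lattice"
  assumes lim: "x \<longlonglongrightarrow> l" and nn: "\<And>n. 0 \<le> x n"
  shows "0 \<le> l"
proof -
  have "norm (pprt (- l)) \<le> norm (x n - l)" for n
  proof -
    have "pprt (- l) \<le> \<bar>x n - l\<bar>"
      unfolding pprt_def
    proof (rule sup_least)
      have "- l \<le> x n - l" using nn[of n] by simp
      also have "\<dots> \<le> \<bar>x n - l\<bar>" by (rule abs_ge_self)
      finally show "- l \<le> \<bar>x n - l\<bar>" .
    qed simp
    then have "norm (pprt (- l)) \<le> norm \<bar>x n - l\<bar>" by (intro norm_mono_nonneg) auto
    then show ?thesis by simp
  qed
  moreover have "(\<lambda>n. norm (x n - l)) \<longlonglongrightarrow> 0"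
    using lim by (simp add: LIM_zero tendsto_norm_zero)
  ultimately have "norm (pprt (- l)) \<le> 0" by (intro LIMSEQ_le_const) auto
  then have "pprt (- l) = 0" by simp
  then have "- l \<le> 0" by (simp only: le_zero_iff_zero_pprt)
  then show ?thesis by simp
qed

lemma sum_le_suminf_lattice:
  fixes x :: "nat \<Rightarrow> 'a::banach_lattice"
  assumes "summable x" "\<And>n. 0 \<le> x n"
  shows "(\<Sum>i<n. x i) \<le> suminf x"
proof -
  have "(\<lambda>m. \<Sum>i<m. x (i + n)) \<longlonglongrightarrow> (\<Sum>i. x (i + n))"
    by (intro summable_LIMSEQ summable_ignore_initial_segment assms)
  then have "0 \<le> (\<Sum>i. x (i + n))"
    by (rule nonneg_LIMSEQ) (intro sum_nonneg assms)
  then show ?thesis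
    using suminf_split_initial_segment[OF assms(1), of n] by simp
qed

lemma pprt_scaleR:
  fixes x :: "'a::banach_lattice"
  assumes "0 \<le> c"
  shows "pprt (c *\<^sub>R x) = c *\<^sub>R pprt x"
proof -
  have two: "2 *\<^sub>R pprt y = \<bar>y\<bar> + y" for y :: 'a
  proof -
    have "2 *\<^sub>R pprt y = (pprt y - nprt y) + (pprt y + nprt y)" by (simp add: scaleR_2)
    then show ?thesis by (simp only: abs_prts prts[symmetric])
  qed
  have "2 *\<^sub>R pprt (c *\<^sub>R x) = 2 *\<^sub>R (c *\<^sub>R pprt x)"
    using assms by (simp only: two abs_scaleR_lattice abs_of_nonneg scaleR_left_commute[of 2 c] scaleR_add_right)
  then show ?thesis by (simp only: scaleR_cancel_left) simp
qed

text \<open>Up to positive factors the two elements are dominated by the positive and the negative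
  part of \<open>a - d *\<^sub>R b\<close>, and these are disjoint.\<close>

lemma inf_pprt_disjoint:
  fixes a b :: "'a::banach_lattice"
  assumes "0 \<le> a" "0 \<le> b" "0 < d" "d \<le> c"
  shows "inf (pprt (a - c *\<^sub>R b)) (pprt (b - inverse d *\<^sub>R a)) = 0"
proof -
  let ?t = "a - d *\<^sub>R b"
  have p: "pprt (a - c *\<^sub>R b) \<le> pprt ?t"
    using scaleR_right_mono[OF assms(4,2)] by (intro pprt_mono diff_left_mono)
  have "d *\<^sub>R (b - inverse d *\<^sub>R a) = - ?t" using assms(3) by (simp add: algebra_simps)
  then have q: "d *\<^sub>R pprt (b - inverse d *\<^sub>R a) = pprt (- ?t)"
    using assms(3) pprt_scaleR[of d "b - inverse d *\<^sub>R a"] by (simp only: less_imp_le)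
  \<comment> \<open>Sum and supremum of the two parts both equal \<open>\<bar>?t\<bar>\<close>,
    which leaves zero for the infimum.\<close>
  have "inf (pprt ?t) (pprt (- ?t)) = 0"
  proof -
    have "pprt ?t + pprt (- ?t) = sup (pprt ?t) (pprt (- ?t)) + inf (pprt ?t) (pprt (- ?t))"
      by (rule add_eq_inf_sup)
    moreover have "pprt ?t + pprt (- ?t) = \<bar>?t\<bar>" by (simp only: abs_prts pprt_neg add_uminus_conv_diff)
    moreover have "sup (pprt ?t) (pprt (- ?t)) = \<bar>?t\<bar>"
    proof -
      have "sup (pprt ?t) (pprt (- ?t)) = sup (sup ?t (- ?t)) 0"
        unfolding pprt_def by (simp only: sup.assoc sup.left_commute sup_commute sup.idem sup.left_idem)
      also have "\<dots> = \<bar>?t\<bar>" unfolding abs_lattice[symmetric] by (simp add: sup_absorb1)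
      finally show ?thesis .
    qed
    ultimately show ?thesis by simp
  qed
  then have "inf \<bar>pprt ?t\<bar> \<bar>pprt (- ?t)\<bar> = 0" by simp
  then have "inf \<bar>pprt (a - c *\<^sub>R b)\<bar> \<bar>pprt (b - inverse d *\<^sub>R a)\<bar> = 0"
  proof (rule inf_le_scaleR_disjoint)
    show "\<bar>pprt (a - c *\<^sub>R b)\<bar> \<le> 1 *\<^sub>R \<bar>pprt ?t\<bar>" using p by simp
    show "\<bar>pprt (b - inverse d *\<^sub>R a)\<bar> \<le> inverse d *\<^sub>R \<bar>pprt (- ?t)\<bar>"
      using assms(3) unfolding q[symmetric] by (simp add: abs_scaleR_lattice)
  qed
  then show ?thesis by simp
qed

lemma pprt_diff_bounds:
  fixes a b :: "'a::lattice_ab_group_add"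
  assumes "0 \<le> b"
  shows "pprt (a - b) \<le> pprt a" "pprt a - pprt (a - b) \<le> b"
proof -
  show "pprt (a - b) \<le> pprt a" using assms by (intro pprt_mono) simp
  have "pprt a \<le> b + pprt (a - b)"
    unfolding pprt_def using assms by (auto simp: add_sup_distrib_left intro: le_supI1 le_supI2)
  then show "pprt a - pprt (a - b) \<le> b" by (simp add: diff_le_eq)
qed

text \<open>Choose \<open>x\<^sub>n\<close> violating the claim for \<open>u = 4\<^sup>n (\<bar>x\<^sub>0\<bar> + \<dots> + \<bar>x\<^sub>n\<^sub>-\<^sub>1\<bar>)\<close>. Subtracting
  a further \<open>2\<^sup>-\<^sup>n y\<close>, where \<open>y = \<Sum>2\<^sup>-\<^sup>i \<bar>x\<^sub>i\<bar>\<close>, makes the positive parts disjoint at a cost that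
  tends to zero.\<close>

lemma disjoint_null_imp_order_tail:
  fixes B :: "'a::banach_lattice set" and G :: "('a \<Rightarrow>\<^sub>L real) set"
  assumes bdd: "bounded B" and solid: "\<And>x y. x \<in> B \<Longrightarrow> \<bar>y\<bar> \<le> \<bar>x\<bar> \<Longrightarrow> y \<in> B"
    and obd: "\<And>u. 0 \<le> u \<Longrightarrow> \<exists>M. \<forall>g\<in>G. \<forall>z. 0 \<le> z \<and> z \<le> u \<longrightarrow> \<bar>blinfun_apply g z\<bar> \<le> M"
    and null: "\<And>v g. range v \<subseteq> B \<Longrightarrow> disjoint_seq v \<Longrightarrow> range g \<subseteq> G \<Longrightarrow>
      (\<lambda>k. blinfun_apply (g k) (v k)) \<longlonglongrightarrow> 0"
    and e: "e > 0"
  shows "\<exists>u\<ge>0. \<forall>x\<in>B. \<forall>g\<in>G. \<bar>blinfun_apply g (pprt (\<bar>x\<bar> - u))\<bar> < e"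
proof (rule ccontr)
  assume "\<not> ?thesis"
  then have "\<forall>u. \<exists>x g. 0 \<le> u \<longrightarrow> x \<in> B \<and> g \<in> G \<and> e \<le> \<bar>blinfun_apply g (pprt (\<bar>x\<bar> - u))\<bar>"
    by (meson not_less)
  then obtain X H where XH: "\<And>u. 0 \<le> u \<Longrightarrow> X u \<in> B" "\<And>u. 0 \<le> u \<Longrightarrow> H u \<in> G"
    "\<And>u. 0 \<le> u \<Longrightarrow> e \<le> \<bar>blinfun_apply (H u) (pprt (\<bar>X u\<bar> - u))\<bar>"
    by metis
  \<comment> \<open>The recursion runs over partial sums, since each new element depends on the
    earlier ones only through their sum \<open>s n\<close>.\<close>
  define s where "s = rec_nat 0 (\<lambda>n t. t + \<bar>X (4 ^ n *\<^sub>R t)\<bar>)"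
  define x where "x n = X (4 ^ n *\<^sub>R s n)" for n
  define g where "g n = H (4 ^ n *\<^sub>R s n)" for n
  have s: "s n = (\<Sum>i<n. \<bar>x i\<bar>)" for n
    by (induction n) (simp_all add: s_def x_def add.commute)
  have s0: "0 \<le> 4 ^ n *\<^sub>R s n" for n
    by (simp add: s scaleR_nonneg_nonneg sum_nonneg)
  have xB: "x n \<in> B" and gG: "g n \<in> G"
    and eg: "e \<le> \<bar>g n (pprt (\<bar>x n\<bar> - 4 ^ n *\<^sub>R s n))\<bar>" for n
    using XH[OF s0[of n]] by (simp_all add: x_def g_def)
  obtain K where K: "\<And>z. z \<in> B \<Longrightarrow> norm z \<le> K" using bdd by (auto simp: bounded_iff)
  define y where "y = (\<Sum>i. (1/2) ^ i *\<^sub>R \<bar>x i\<bar>)"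
  have sy: "summable (\<lambda>i. (1/2) ^ i *\<^sub>R \<bar>x i\<bar>)"
  proof (rule summable_comparison_test'[where g = "\<lambda>i. (1/2) ^ i * K"])
    show "summable (\<lambda>i. (1/2) ^ i * K :: real)" by (intro summable_mult2 summable_geometric) simp
    show "norm ((1/2) ^ n *\<^sub>R \<bar>x n\<bar>) \<le> (1/2) ^ n * K" for n
      using K[OF xB[of n]] by (simp add: mult_left_mono)
  qed
  have part: "(\<Sum>i<n. (1/2) ^ i *\<^sub>R \<bar>x i\<bar>) \<le> y" for n
    unfolding y_def by (rule sum_le_suminf_lattice[OF sy]) (simp add: scaleR_nonneg_nonneg)
  have y_ge: "(1/2) ^ i *\<^sub>R \<bar>x i\<bar> \<le> y" for i
  proof -
    have "(1/2) ^ i *\<^sub>R \<bar>x i\<bar> \<le> (\<Sum>i<Suc i. (1/2) ^ i *\<^sub>R \<bar>x i\<bar>)"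
      using sum_mono2[of "{..<Suc i}" "{i}" "\<lambda>i. (1/2) ^ i *\<^sub>R \<bar>x i\<bar>"]
      by (simp add: scaleR_nonneg_nonneg)
    then show ?thesis using part by (rule order_trans)
  qed
  have y0: "0 \<le> y" using part[of 0] by simp
  define w where "w n = \<bar>x n\<bar> - 4 ^ n *\<^sub>R s n" for n
  define v where "v n = pprt (w n - (1/2) ^ n *\<^sub>R y)" for n
  have hy0: "0 \<le> (1/2) ^ n *\<^sub>R y" for n using y0 by (simp add: scaleR_nonneg_nonneg)
  have wx: "w n \<le> \<bar>x n\<bar>" for n using s0[of n] by (simp add: w_def)
  have vB: "v n \<in> B" for n
  proof (rule solid[OF xB[of n]])
    have "w n - (1/2) ^ n *\<^sub>R y \<le> \<bar>x n\<bar>"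
      using wx[of n] hy0[of n] by (meson diff_le_eq le_add_same_cancel1 order_trans)
    then have "v n \<le> pprt \<bar>x n\<bar>" unfolding v_def by (rule pprt_mono)
    then show "\<bar>v n\<bar> \<le> \<bar>x n\<bar>" by (simp add: v_def)
  qed
  have disj: "inf \<bar>v n\<bar> \<bar>v m\<bar> = 0" if mn: "m < n" for m n
  proof -
    \<comment> \<open>The term \<open>(1/2) ^ m *\<^sub>R y\<close> dominates
      \<open>inverse ?d *\<^sub>R \<bar>x n\<bar>\<close>, and \<open>4 ^ n *\<^sub>R s n\<close>
      dominates \<open>4 ^ n *\<^sub>R \<bar>x m\<bar>\<close>. Since \<open>m < n\<close>,
      \<open>?d \<le> 4 ^ n\<close>, as the disjointness lemma requires.\<close>
    let ?d = "2 ^ (m + n) :: real"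
    have "(2::real) ^ (m + n) \<le> 2 ^ (2 * n)" using mn by (intro power_increasing) auto
    then have d: "?d \<le> 4 ^ n" by (simp add: power_mult)
    have "\<bar>x m\<bar> \<le> s n" 
      using sum_mono2[of "{..<n}" "{m}" "\<lambda>i. \<bar>x i\<bar>"] mn by (simp add: s)
    then have "4 ^ n *\<^sub>R \<bar>x m\<bar> \<le> 4 ^ n *\<^sub>R s n" by (intro scaleR_left_mono) auto
    then have "w n - (1/2) ^ n *\<^sub>R y \<le> \<bar>x n\<bar> - 4 ^ n *\<^sub>R \<bar>x m\<bar>"
      using hy0[of n] unfolding w_def by (meson diff_left_mono diff_le_eq le_add_same_cancel1 order_trans)
    then have 1: "v n \<le> pprt (\<bar>x n\<bar> - 4 ^ n *\<^sub>R \<bar>x m\<bar>)" unfolding v_def by (rule pprt_mono)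
    have "(1/2) ^ m *\<^sub>R ((1/2) ^ n *\<^sub>R \<bar>x n\<bar>) \<le> (1/2) ^ m *\<^sub>R y"
      by (intro scaleR_left_mono y_ge) simp
    then have "inverse ?d *\<^sub>R \<bar>x n\<bar> \<le> (1/2) ^ m *\<^sub>R y"
      by (simp add: power_add power_one_over field_simps)
    then have "w m - (1/2) ^ m *\<^sub>R y \<le> \<bar>x m\<bar> - inverse ?d *\<^sub>R \<bar>x n\<bar>"
      using wx[of m] by (rule diff_mono[rotated])
    then have 2: "v m \<le> pprt (\<bar>x m\<bar> - inverse ?d *\<^sub>R \<bar>x n\<bar>)" unfolding v_def by (rule pprt_mono)
    have "inf (v n) (v m) \<le> inf (pprt (\<bar>x n\<bar> - 4 ^ n *\<^sub>R \<bar>x m\<bar>)) (pprt (\<bar>x m\<bar> - inverse ?d *\<^sub>R \<bar>x n\<bar>))"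
      using 1 2 by (rule inf_mono)
    also have "\<dots> = 0" using d by (intro inf_pprt_disjoint) auto
    finally show ?thesis by (simp add: v_def antisym)
  qed
  have "disjoint_seq v"
    unfolding disjoint_seq_def using disj by (metis inf_commute linorder_neqE_nat)
  then have lim1: "(\<lambda>n. \<bar>g n (v n)\<bar>) \<longlonglongrightarrow> 0"
    using vB gG by (intro tendsto_rabs_zero null) auto
  obtain M where M: "\<And>h z. h \<in> G \<Longrightarrow> 0 \<le> z \<Longrightarrow> z \<le> y \<Longrightarrow> \<bar>blinfun_apply h z\<bar> \<le> M"
    using obd[OF y0] by blast
  \<comment> \<open>Scaled by \<open>2 ^ n\<close>, the discarded piece lies between
    \<open>0\<close> and \<open>y\<close>, where all of \<open>G\<close> is bounded by the single
    constant \<open>M\<close>.\<close>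
  have diff: "\<bar>g n (pprt (w n)) - g n (v n)\<bar> \<le> (1/2) ^ n * M" for n
  proof -
    let ?z = "pprt (w n) - v n"
    have z: "0 \<le> ?z" "?z \<le> (1/2) ^ n *\<^sub>R y"
      using pprt_diff_bounds[OF hy0[of n], of "w n"] by (simp_all add: v_def)
    have "0 \<le> 2 ^ n *\<^sub>R ?z" by (rule scaleR_nonneg_nonneg[OF _ z(1)]) simp
    moreover have "2 ^ n *\<^sub>R ?z \<le> 2 ^ n *\<^sub>R (1/2) ^ n *\<^sub>R y"
      by (rule scaleR_left_mono[OF z(2)]) simp
    ultimately have "\<bar>g n (2 ^ n *\<^sub>R ?z)\<bar> \<le> M"
      by (intro M gG) (simp_all add: power_one_over)
    then have "2 ^ n * \<bar>g n ?z\<bar> \<le> M" by (simp only: blinfun.scaleR_right abs_mult real_scaleR_def) simp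
    then show ?thesis by (simp add: blinfun.diff_right power_one_over field_simps)
  qed
  have "(\<lambda>n. \<bar>g n (v n)\<bar> + (1/2) ^ n * M) \<longlonglongrightarrow> 0 + 0 * M"
    by (intro tendsto_add lim1 tendsto_mult_right LIMSEQ_realpow_zero) auto
  moreover have "e \<le> \<bar>g n (v n)\<bar> + (1/2) ^ n * M" for n
    using diff[of n] eg[of n, folded w_def] by linarith
  ultimately have "e \<le> 0" by (intro LIMSEQ_le_const) auto
  with e show False by simp
qed

section \<open>Dunford-Pettis sets and the two implications\<close>

lemma Dunford_Pettis_set_eventually_less:
  fixes f :: "nat \<Rightarrow> 'a::banach \<Rightarrow>\<^sub>L real"
  assumes DP: "Dunford_Pettis_set A" and f: "weakly_null f" and e: "e > 0"
  shows "\<forall>\<^sub>F n in sequentially. \<forall>x\<in>A. \<bar>blinfun_apply (f n) x\<bar> < e"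
proof -
  have "(\<lambda>n. SUP x\<in>A. ennreal \<bar>blinfun_apply (f n) x\<bar>) \<longlonglongrightarrow> 0"
    using DP f by (simp add: Dunford_Pettis_set_def)
  then have "\<forall>\<^sub>F n in sequentially. (SUP x\<in>A. ennreal \<bar>blinfun_apply (f n) x\<bar>) < ennreal e"
    using e by (intro order_tendstoD) auto
  then show ?thesis
  proof (rule eventually_mono, intro ballI)
    fix n x assume "(SUP x\<in>A. ennreal \<bar>blinfun_apply (f n) x\<bar>) < ennreal e" "x \<in> A"
    then have "ennreal \<bar>blinfun_apply (f n) x\<bar> < ennreal e"
      by (meson SUP_upper le_less_trans)
    then show "\<bar>blinfun_apply (f n) x\<bar> < e" by (simp add: ennreal_less_iff)
  qed
qed

lemma Dunford_Pettis_setI: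
  fixes A :: "'a::banach set"
  assumes bdd: "bounded A"
    and ev: "\<And>(f :: nat \<Rightarrow> 'a \<Rightarrow>\<^sub>L real) e. weakly_null f \<Longrightarrow> e > 0 \<Longrightarrow>
      \<forall>\<^sub>F n in sequentially. \<forall>x\<in>A. \<bar>blinfun_apply (f n) x\<bar> \<le> e"
  shows "Dunford_Pettis_set A"
  unfolding Dunford_Pettis_set_def
proof (intro conjI allI impI bdd)
  fix f :: "nat \<Rightarrow> 'a \<Rightarrow>\<^sub>L real" assume f: "weakly_null f"
  show "(\<lambda>n. SUP x\<in>A. ennreal \<bar>blinfun_apply (f n) x\<bar>) \<longlonglongrightarrow> 0"
  proof (rule order_tendstoI)
    fix c :: ennreal assume "0 < c"
    \<comment> \<open>An intermediate \<open>d\<close> is finite even if \<open>c\<close> is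
      infinite, and it turns the non-strict bound on the supremum into a strict one.\<close>
    then obtain d where d: "0 < d" "d < c" using dense by blast
    then have dt: "d < top" using less_top order.strict_trans by auto
    define e where "e = enn2real d"
    have e: "e > 0" "ennreal e = d"
      using d dt by (auto simp: e_def enn2real_positive_iff)
    show "\<forall>\<^sub>F n in sequentially. (SUP x\<in>A. ennreal \<bar>blinfun_apply (f n) x\<bar>) < c"
      using ev[OF f e(1)]
    proof (rule eventually_mono)
      fix n assume "\<forall>x\<in>A. \<bar>blinfun_apply (f n) x\<bar> \<le> e"
      then have "(SUP x\<in>A. ennreal \<bar>blinfun_apply (f n) x\<bar>) \<le> d"
        unfolding e(2)[symmetric] by (intro SUP_least ennreal_leI) auto
      then show "(SUP x\<in>A. ennreal \<bar>blinfun_apply (f n) x\<bar>) < c" using d(2) by (rule le_less_trans)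
    qed
  qed simp
qed

text \<open>The functionals \<open>f n\<close> become small uniformly on the image of the whole
  range of \<open>x\<close>, in particular at the diagonal points \<open>T (x n)\<close>.\<close>

lemma DW_DP_imp_weak_Dunford_Pettis:
  fixes T :: "'a::banach_lattice \<Rightarrow>\<^sub>L 'b::banach"
  assumes "DW_DP T"
  shows "weak_Dunford_Pettis T"
  unfolding weak_Dunford_Pettis_def
proof (intro allI impI, elim conjE)
  fix x :: "nat \<Rightarrow> 'a" and f :: "nat \<Rightarrow> 'b \<Rightarrow>\<^sub>L real"
  assume x: "weakly_null x" and f: "weakly_null f"
  have DP: "Dunford_Pettis_set (T ` range x)"
    using assms weakly_null_disjointly_weakly_compact[OF x] by (simp add: DW_DP_def)
  show "(\<lambda>n. blinfun_apply (f n) (T (x n))) \<longlonglongrightarrow> 0"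
  proof (rule tendstoI)
    fix e :: real assume "e > 0"
    then show "\<forall>\<^sub>F n in sequentially. dist (blinfun_apply (f n) (T (x n))) 0 < e"
      by (rule eventually_mono[OF Dunford_Pettis_set_eventually_less[OF DP f]]) simp
  qed
qed

lemma weak_order_Dunford_Pettis_imp_DW_DP:
  fixes T :: "'a::banach_lattice \<Rightarrow>\<^sub>L 'b::banach"
  assumes weak: "weak_Dunford_Pettis T" and ord: "order_Dunford_Pettis T"
  shows "DW_DP T"
  unfolding DW_DP_def
proof (intro allI impI)
  fix A :: "'a set" assume "disjointly_weakly_compact A"
  then have A: "bounded A" "\<And>x. range x \<subseteq> Sol A \<Longrightarrow> disjoint_seq x \<Longrightarrow> weakly_null x"
    by (auto simp: disjointly_weakly_compact_def)
  have DP_Icc: "Dunford_Pettis_set (T ` {0..u})" for u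
    using ord by (auto simp: order_Dunford_Pettis_def order_bounded_def)
  show "Dunford_Pettis_set (T ` A)"
  proof (rule Dunford_Pettis_setI)
    show "bounded (T ` A)" by (rule bounded_linear_image[OF A(1) blinfun.bounded_linear_right])
    fix f :: "nat \<Rightarrow> 'b \<Rightarrow>\<^sub>L real" and e :: real assume f: "weakly_null f" and e: "e > 0"
    define h where "h n = f n o\<^sub>L T" for n
    have "\<exists>u\<ge>0. \<forall>x\<in>Sol A. \<forall>g\<in>range h. \<bar>blinfun_apply g (pprt (\<bar>x\<bar> - u))\<bar> < e / 4"
    proof (rule disjoint_null_imp_order_tail)
      show "bounded (Sol A)" by (rule bounded_Sol[OF A(1)])
      show "x \<in> Sol A \<Longrightarrow> \<bar>y\<bar> \<le> \<bar>x\<bar> \<Longrightarrow> y \<in> Sol A" for x y by (rule Sol_mono_abs)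
      show "e / 4 > 0" using e by simp
    next
      fix u :: 'a assume "0 \<le> u"
      \<comment> \<open>From \<open>N\<close> on, the order Dunford-Pettis property bounds
        \<open>h n\<close> by \<open>1\<close> on the interval; the finitely many earlier
        functionals are bounded by their norms.\<close>
      obtain N where N: "\<And>n x. n \<ge> N \<Longrightarrow> x \<in> T ` {0..u} \<Longrightarrow> \<bar>f n x\<bar> < 1"
        using Dunford_Pettis_set_eventually_less[OF DP_Icc f, of 1 u]
        unfolding eventually_sequentially by auto
      define M where "M = 1 + (\<Sum>n<N. norm (h n) * norm u)"
      have "\<bar>h n z\<bar> \<le> M" if z: "0 \<le> z" "z \<le> u" for n z
      proof (cases "n < N")
        case True
        have "\<bar>h n z\<bar> \<le> norm (h n) * norm z" using norm_blinfun[of "h n" z] by simp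
        also have "\<dots> \<le> norm (h n) * norm u" by (intro mult_left_mono norm_mono_nonneg z) simp
        also have "\<dots> \<le> (\<Sum>n<N. norm (h n) * norm u)" using True by (intro member_le_sum) auto
        finally show ?thesis by (simp add: M_def)
      next
        case False
        then have "\<bar>h n z\<bar> < 1" using N[of n "T z"] z by (simp add: h_def)
        moreover have "0 \<le> (\<Sum>n<N. norm (h n) * norm u)" by (intro sum_nonneg) simp
        ultimately show ?thesis by (simp add: M_def)
      qed
      then show "\<exists>M. \<forall>g\<in>range h. \<forall>z. 0 \<le> z \<and> z \<le> u \<longrightarrow> \<bar>blinfun_apply g z\<bar> \<le> M" by blast
    next
      fix v :: "nat \<Rightarrow> 'a" and g :: "nat \<Rightarrow> 'a \<Rightarrow>\<^sub>L real"
      assume vA: "range v \<subseteq> Sol A" and v: "disjoint_seq v" and gh: "range g \<subseteq> range h"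
      have "\<exists>n. g k = h n" for k
      proof -
        have "g k \<in> range h" using gh by (rule subsetD) simp
        then show ?thesis by blast
      qed
      then obtain n where n: "\<And>k. g k = h (n k)" by metis
      have vnull: "weakly_null v" using A(2)[OF vA v] .
      have "(\<lambda>k. h (n k) (v k)) \<longlonglongrightarrow> 0"
      \<comment> \<open>The functional paired with \<open>v k\<close> is \<open>h (n k)\<close> with
        \<open>n\<close> arbitrary. A fixed functional needs only that \<open>v\<close> is weakly
        null; if the index tends to infinity, the weak Dunford-Pettis property applies.\<close>
      proof (rule tendsto_0_dichotomy[of n])
        fix r :: "nat \<Rightarrow> nat" and m assume r: "strict_mono r" "\<And>k. n (r k) = m"
        have "weakly_null (\<lambda>k. v (r k))"
          by (rule weakly_null_compose[OF vnull filterlim_subseq[OF r(1)]])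
        then show "(\<lambda>k. h (n (r k)) (v (r k))) \<longlonglongrightarrow> 0" by (simp add: weakly_null_def r(2))
      next
        fix r :: "nat \<Rightarrow> nat" assume r: "strict_mono r" "filterlim (\<lambda>k. n (r k)) at_top sequentially"
        have "weakly_null (\<lambda>k. v (r k))"
          by (rule weakly_null_compose[OF vnull filterlim_subseq[OF r(1)]])
        moreover have "weakly_null (\<lambda>k. f (n (r k)))"
          by (rule weakly_null_compose[OF f r(2)])
        ultimately have lim: "(\<lambda>k. h (n (r k)) (v (r k))) \<longlonglongrightarrow> 0"
          using weak by (simp add: weak_Dunford_Pettis_def h_def)
        show "\<forall>d>0. \<exists>k. \<bar>h (n (r k)) (v (r k))\<bar> < d"
        proof (intro allI impI)
          fix d :: real assume "d > 0"
          then have "\<forall>\<^sub>F k in sequentially. dist (h (n (r k)) (v (r k))) 0 < d"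
            using lim by (rule tendstoD[rotated])
          then show "\<exists>k. \<bar>h (n (r k)) (v (r k))\<bar> < d"
            by (auto simp: eventually_sequentially)
        qed
      qed
      then show "(\<lambda>k. blinfun_apply (g k) (v k)) \<longlonglongrightarrow> 0" by (simp add: n)
    qed
    then obtain u where u0: "u \<ge> 0"
      and u: "\<And>x n. x \<in> Sol A \<Longrightarrow> \<bar>h n (pprt (\<bar>x\<bar> - u))\<bar> < e / 4" by blast
    have "\<forall>\<^sub>F n in sequentially. \<forall>x\<in>T ` {0..u}. \<bar>blinfun_apply (f n) x\<bar> < e / 4"
      using e by (intro Dunford_Pettis_set_eventually_less DP_Icc f) simp
    then show "\<forall>\<^sub>F n in sequentially. \<forall>x\<in>T ` A. \<bar>blinfun_apply (f n) x\<bar> \<le> e"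
    proof (rule eventually_mono, intro ballI)
      fix n x assume n: "\<forall>x\<in>T ` {0..u}. \<bar>blinfun_apply (f n) x\<bar> < e / 4" and "x \<in> T ` A"
      then obtain a where a: "a \<in> A" "x = T a" by blast
      \<comment> \<open>A positive \<open>b\<close> splits into \<open>inf b u\<close>, which lies
        in \<open>{0..u}\<close>, and the tail \<open>pprt (b - u)\<close>; each part costs less
        than \<open>e / 4\<close>. The positive and negative parts of \<open>a\<close> then add up
        to at most \<open>e\<close>.\<close>
      have pos: "\<bar>h n b\<bar> < e / 2" if b: "0 \<le> b" "b \<in> Sol A" for b
      proof -
        have "b - pprt (b - u) = inf b u"
        proof -
          have "b - pprt (b - u) = b + inf (- (b - u)) (- 0)"
            unfolding pprt_def by (rule diff_sup_eq_inf)
          also have "\<dots> = inf u b" by (simp add: add_inf_distrib_left)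
          finally show ?thesis by (simp add: inf_commute)
        qed
        then have "\<bar>h n (b - pprt (b - u))\<bar> < e / 4"
          using n b u0 by (simp add: h_def)
        moreover have "\<bar>h n (pprt (b - u))\<bar> < e / 4" using u[OF b(2), of n] b(1) by simp
        ultimately show ?thesis unfolding blinfun.diff_right by linarith
      qed
      have aS: "a \<in> Sol A" using a(1) subset_Sol by blast
      have le: "pprt c \<le> \<bar>c\<bar>" for c :: 'a by (simp add: pprt_def abs_ge_self)
      have "\<bar>h n (pprt c)\<bar> < e / 2" if "\<bar>c\<bar> = \<bar>a\<bar>" for c
        by (rule pos[OF zero_le_pprt Sol_mono_abs[OF aS]]) (use le[of c] that in simp)
      from this[of a] this[of "- a"]
      have "\<bar>h n (pprt a)\<bar> < e / 2" "\<bar>h n (pprt (- a))\<bar> < e / 2" by simp_all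
      moreover have "h n a = h n (pprt a) - h n (pprt (- a))"
        using arg_cong[OF prts[of a], of "h n"] by (simp add: pprt_neg blinfun.add_right blinfun.minus_right)
      ultimately have "\<bar>h n a\<bar> \<le> e" by linarith
      then show "\<bar>f n x\<bar> \<le> e" by (simp add: a(2) h_def)
    qed
  qed
qed

theorem theorem2p12:
  fixes T :: "'a::banach_lattice \<Rightarrow>\<^sub>L 'b::banach"
  shows "DW_DP T \<longleftrightarrow> weak_Dunford_Pettis T \<and> order_Dunford_Pettis T"
proof (intro iffI conjI)
  assume T: "DW_DP T"
  show "weak_Dunford_Pettis T" by (rule DW_DP_imp_weak_Dunford_Pettis[OF T])
  show "order_Dunford_Pettis T"
    using T order_bounded_disjointly_weakly_compact by (auto simp: DW_DP_def order_Dunford_Pettis_def)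
qed (blast intro: weak_order_Dunford_Pettis_imp_DW_DP)

end
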